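(* Let $k$ and $\ell$ be positive integers and write $m:=2^{\mathrm{ord}_2(\gcd(k,\ell))}$. Suppose that $q:=2^k$ and $Q:=2^\ell$ satisfy $\gcd(Q-1,q+1)=1$. Write $A(X):=1+aX^u+dX^v$ where $a,d\in\mathbb{F}_q$ and $u,v$ are positive integers such that $u(Q-1)\equiv Q\pmod{q+1}$ and $v(Q-1)\equiv q\pmod{q+1}$. Then $f(X):=XA(X^{q-1})$ permutes $\mathbb{F}_{q^2}$ if and only if all of the following hold: (1) $e:=1+a^2+d^2$ is nonzero; (2) $d^Q=e^{Q-1}a$; (3) $\mathrm{Tr}_{\mathbb{F}_q/\mathbb{F}_{2^m}}\Bigl(\frac{a^2+d^2}{e}\Bigr)=0$.
   Context: For a positive integer $n$, $\mathrm{ord}_2(n)$ is the largest integer $i\ge0$ with $2^i\mid n$. A polynomial permutes $\mathbb{F}_{q^2}$ if it induces a bijection of $\mathbb{F}_{q^2}$. $\mathrm{Tr}_{\mathbb{F}_q/\mathbb{F}_{2^m}}$ is the trace map (note $m\mid k$). *)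

theory Defs
  imports "HOL-Library.Cardinality" "HOL-Computational_Algebra.Polynomial"
    "HOL-Computational_Algebra.Primes" "HOL-Number_Theory.Cong"
begin

text \<open>
  A finite field of order \<open>N\<close> is a type of class \<^class>\<open>finite_field\<close> with \<open>N\<close> elements.
  If \<open>N\<close> is a power of \<open>r\<close>, then its subfield of order \<open>r\<close> is the fixed set of
  \<open>x \<mapsto> x ^ r\<close>.  The lemmas below confirm that this set is a subfield, that it has \<open>r\<close>
  elements, and that it contains every subfield with \<open>r\<close> elements.
\<close>

definition GF_sub :: "nat \<Rightarrow> 'a :: finite_field set" where
  "GF_sub r = {x. x ^ r = x}"

text \<open>
  The trace map from the field of order \<open>r ^ n\<close> to its subfield of order \<open>r\<close>: the sum of the
  \<open>n\<close> conjugates \<open>x ^ (r ^ i)\<close> of \<open>x\<close> over the subfield.  It is meant for arguments in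
  \<open>GF_sub (r ^ n)\<close>; its values, which then lie in \<open>GF_sub r\<close>, are taken as elements of the
  ambient field.
\<close>

definition GF_trace :: "nat \<Rightarrow> nat \<Rightarrow> 'a :: finite_field \<Rightarrow> 'a" where
  "GF_trace r n x = (\<Sum>i<n. x ^ (r ^ i))"

lemma GF_sub_closed:
  fixes x y :: "'a :: finite_field"
  assumes r: "r = CHAR('a) ^ j" and x: "x \<in> GF_sub r" and y: "y \<in> GF_sub r"
  shows "0 \<in> (GF_sub r :: 'a set)" "1 \<in> (GF_sub r :: 'a set)" "x + y \<in> GF_sub r"
    "- x \<in> GF_sub r" "x * y \<in> GF_sub r" "inverse x \<in> GF_sub r"
proof -
  have r0: "r > 0" using r by simp
  have add: "(a + b) ^ r = a ^ r + b ^ r" for a b :: 'a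
    by (rule freshmans_dream') (use r in auto)
  show "0 \<in> (GF_sub r :: 'a set)" "1 \<in> (GF_sub r :: 'a set)" using r0 by (auto simp: GF_sub_def)
  show "x + y \<in> GF_sub r" using x y by (simp add: GF_sub_def add)
  show "x * y \<in> GF_sub r" using x y by (simp add: GF_sub_def power_mult_distrib)
  show "inverse x \<in> GF_sub r" using x by (simp add: GF_sub_def power_inverse)
  have "x ^ r + (- x) ^ r = 0" using add[of x "- x"] r0 by (simp add: zero_power)
  thus "- x \<in> GF_sub r" using x by (simp add: GF_sub_def eq_neg_iff_add_eq_0 add.commute)
qed

lemma card_GF_sub:
  assumes N: "CARD('a :: finite_field) = r ^ n" and r: "r > 1" and n: "n > 0"
  shows "card (GF_sub r :: 'a set) = r"
proof -
  define K where "K = (\<Sum>j<n. r ^ j)"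
  define p :: "'a poly" where "p = monom 1 r - monom 1 1"
  define g :: "'a poly" where "g = (\<Sum>i<K. monom 1 ((r - 1) * i))"
  have K: "r ^ n = 1 + (r - 1) * K"
  proof -
    have "int r ^ n - 1 = (int r - 1) * (\<Sum>j<n. int r ^ j)"
      by (rule power_diff_1_eq)
    hence "int (r ^ n) = int (1 + (r - 1) * K)"
      using r by (simp add: K_def of_nat_diff)
    thus ?thesis by linarith
  qed
  have K0: "K > 0" unfolding K_def using n r by (auto intro!: sum_pos)
  have fac: "x ^ r ^ n - x = poly p x * poly g x" for x :: 'a
  proof -
    have "poly p x * poly g x = x * ((x ^ (r - 1) - 1) * (\<Sum>i<K. (x ^ (r - 1)) ^ i))"
      using r by (cases r) (auto simp: p_def g_def poly_monom poly_sum power_mult algebra_simps)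
    also have "(x ^ (r - 1) - 1) * (\<Sum>i<K. (x ^ (r - 1)) ^ i) = (x ^ (r - 1)) ^ K - 1"
      by (simp add: power_diff_1_eq)
    finally have "poly p x * poly g x = x * ((x ^ (r - 1)) ^ K - 1)" .
    thus ?thesis unfolding K power_add power_mult by (simp add: right_diff_distrib)
  qed
  have "coeff p r = 1" using r by (simp add: p_def)
  hence p0: "p \<noteq> 0" by auto
  have dp: "degree p \<le> r"
    unfolding p_def using r by (intro degree_diff_le order.trans[OF degree_monom_le]) auto
  have "poly g 0 = (\<Sum>i<K. if i = 0 then 1 else 0)"
    unfolding g_def poly_sum poly_monom using r by (intro sum.cong) auto
  hence "poly g 0 = 1" using K0 by simp
  hence g0: "g \<noteq> 0" by auto
  have dg: "degree g \<le> (r - 1) * (K - 1)"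
    unfolding g_def
    by (intro degree_sum_le order.trans[OF degree_monom_le] mult_le_mono) auto
  have eq: "(GF_sub r :: 'a set) = {x. poly p x = 0}"
    by (auto simp: GF_sub_def p_def poly_monom)
  have "poly p x = 0 \<or> poly g x = 0" for x
    using fac[of x] finite_field_power_card_eq_same[of x] N by simp
  hence "UNIV = {x. poly p x = 0} \<union> {x. poly g x = 0}" by auto
  hence "r ^ n \<le> card {x. poly p x = 0} + card {x. poly g x = 0}"
    using card_Un_le N by metis
  also have "card {x. poly g x = 0} \<le> (r - 1) * (K - 1)"
    using card_poly_roots_bound[OF g0] dg by linarith
  finally have "r ^ n \<le> card {x. poly p x = 0} + (r - 1) * (K - 1)" by simp
  moreover have "r ^ n = r + (r - 1) * (K - 1)"
    using K K0 r by (cases K) auto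
  ultimately have "r \<le> card {x. poly p x = 0}" by linarith
  moreover have "card {x. poly p x = 0} \<le> r"
    using card_poly_roots_bound[OF p0] dp by linarith
  ultimately show ?thesis unfolding eq by linarith
qed

lemma subset_GF_sub:
  fixes S :: "'a :: finite_field set"
  assumes "0 \<in> S" and mult: "\<And>x y. x \<in> S \<Longrightarrow> y \<in> S \<Longrightarrow> x * y \<in> S" and r: "card S = r"
  shows "S \<subseteq> GF_sub r"
proof
  fix x assume x: "x \<in> S"
  have r0: "r > 0" using r \<open>0 \<in> S\<close> by (auto simp: card_gt_0_iff)
  show "x \<in> GF_sub r"
  proof (cases "x = 0")
    case True
    thus ?thesis using r0 by (simp add: GF_sub_def)
  next
    case False
    have inj: "inj_on ((*) x) (S - {0})" using False by (auto simp: inj_on_def)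
    have "(*) x ` (S - {0}) = S - {0}"
      by (rule card_subset_eq) (use False x mult inj in \<open>auto simp: card_image\<close>)
    hence "(\<Prod>y\<in>S-{0}. y) = (\<Prod>y\<in>S-{0}. x * y)"
      using prod.reindex[OF inj, of "\<lambda>y. y"] by simp
    also have "\<dots> = x ^ (r - 1) * (\<Prod>y\<in>S-{0}. y)"
      using r \<open>0 \<in> S\<close> by (simp add: prod.distrib)
    finally have "x ^ (r - 1) = 1" by simp
    hence "x ^ r = x" using r0 by (cases r) auto
    thus ?thesis by (simp add: GF_sub_def)
  qed
qed

lemma GF_trace_in_GF_sub:
  fixes x :: "'a :: finite_field"
  assumes r: "r = CHAR('a) ^ j" and x: "x \<in> GF_sub (r ^ n)"
  shows "GF_trace r n x \<in> GF_sub r"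
proof -
  have add: "(a + b) ^ r = a ^ r + b ^ r" for a b :: 'a
    by (rule freshmans_dream') (use r in auto)
  have "(\<Sum>i<k. x ^ (r ^ i)) ^ r = (\<Sum>i<k. x ^ (r ^ Suc i))" for k
  proof (induction k)
    case 0
    show ?case using r by simp
  next
    case (Suc k)
    have "(x ^ (r ^ k)) ^ r = x ^ (r ^ Suc k)"
      by (simp add: mult.commute flip: power_mult)
    thus ?case by (simp only: sum.lessThan_Suc add Suc.IH)
  qed
  moreover have "(\<Sum>i<n. x ^ (r ^ Suc i)) = (\<Sum>i<n. x ^ (r ^ i))"
    using sum.lessThan_Suc_shift[of "\<lambda>i. x ^ (r ^ i)" n] x
    by (simp add: GF_sub_def)
  ultimately show ?thesis by (simp add: GF_trace_def GF_sub_def)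
qed

end

(*
  The polynomial f permutes the field iff x -> x A(x)^(q-1) permutes the group mu of (q+1)-st roots of
  unity and A has no root there.  Since Q - 1 is coprime to q + 1, put x = y^(Q-1); the map becomes
  h = N/D with D(y) = a y^(Q+1) + y + d and N(y) = d y^(Q+1) + y^Q + a = y^(Q+1) conj(D(y)).
  So the question is whether N(y) D(z) = N(z) D(y) for some y <> z in mu (this covers D(y) = 0 too).

  In V = y/(y+z), which ranges over the elements with V^q = V + 1, and U = (1+yz)/(y+z) in F_q this
  equation is e (V^Q + V + 1) + a U^Q + d U + 1 = 0.  If e = 0, then y = 1 has U = 1 and solves it.
  If e <> 0, set alpha^Q = a/e, beta = d/e, c = 1 + 1/e, b = alpha + beta; it reads
    V^Q + V + (alpha U)^Q + beta U + c = 0,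
  condition (2) is b = 0 and condition (3) is Tr(c) = 0.  The trace of the left side to F_{2^m} is
  1 + Tr(bU) + Tr(c), which proves sufficiency; (3) is necessary given (2) by taking U = 0.

  That b = 0 is necessary: let g = gcd(k,l).  For fixed y the equation is affine in V, so its linear
  part is singular, whence 1 + alpha x and 1 + beta x have the same norm to F_{2^g} for x = y + 1/y.  If
  g > 1, these norms are polynomials in x of degree less than the number q/2 of values x, so alpha = beta.
  If g = 1, substitute V = W + alpha U, which gives W^Q + W = b U + c.  Solving for W^2 + W by an explicit
  additive polynomial Theta, one gets Tr((Theta(bU + c) + alpha^2) / U^2) = 0 for all U with Tr(bU) = 1.
  Multiplying by U Tr(bU) and summing over U in F_q - {0} determines K = Theta(c) + alpha^2 as
  p (b^2 + 1) + r b^2 with p, r in F_2, which is incompatible with K + K^Q = b^2 unless b = 0.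
*)

theory Submission
  imports Defs
begin

subsection \<open>The field of order \<open>q\<^sup>2\<close> in characteristic 2\<close>

lemma card_le_of_poly_roots:
  fixes p :: "'a :: idom poly"
  assumes "p \<noteq> 0" "degree p \<le> n" "\<And>x. x \<in> S \<Longrightarrow> poly p x = 0"
  shows "card S \<le> n"
proof -
  have sub: "S \<subseteq> {x. poly p x = 0}" using assms(3) by auto
  have fin: "finite {x. poly p x = 0}" using assms(1) by (rule poly_roots_finite)
  have "card S \<le> card {x. poly p x = 0}" by (rule card_mono[OF fin sub])
  also have "\<dots> \<le> degree p" by (rule card_poly_roots_bound[OF assms(1)])
  finally show ?thesis using assms(2) by simp
qed

lemma card_le_mult_card_image:
  assumes "finite A" and "\<And>y. y \<in> f ` A \<Longrightarrow> card {x \<in> A. f x = y} \<le> n"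
  shows "card A \<le> n * card (f ` A)"
proof -
  have "card A = (\<Sum>y\<in>f ` A. card {x \<in> A. f x = y})"
    using sum.image_gen[OF assms(1), of "\<lambda>_. 1 :: nat" f] by simp
  also have "\<dots> \<le> (\<Sum>y\<in>f ` A. n)" by (intro sum_mono assms)
  finally show ?thesis by (simp add: mult.commute)
qed

text \<open>The field has \<open>q ^ 2\<close> elements with \<open>q = 2 ^ k\<close>. Frobenius
  maps are written \<open>x ^ 2 ^ i\<close> throughout, so conjugation over F_q is
  \<open>x ^ 2 ^ k\<close>. The parameter \<open>ty\<close> lets an interpretation name the field
  type.\<close>

locale even_quadratic_ext =
  fixes k :: nat and ty :: "'a :: finite_field itself"
  assumes k0: "k > 0" and card_field: "CARD('a) = (2 ^ k) ^ 2"
begin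

lemma two_eq_0: "(2 :: 'a) = 0"
proof -
  have "(- 1 :: 'a) ^ CARD('a) = - 1" by (rule finite_field_power_card_eq_same)
  moreover have "even (CARD('a))" using card_field k0 by simp
  ultimately have "(1 :: 'a) = - 1" by simp
  hence "(1 :: 'a) + 1 = 0" by (simp only: eq_neg_iff_add_eq_0)
  thus ?thesis by simp
qed

lemma CHAR_2: "CHAR('a) = 2"
proof -
  have "CHAR('a) dvd 2" using two_eq_0 of_nat_eq_0_iff_char_dvd[where 'a='a, of 2] by simp
  moreover have "CHAR('a) \<noteq> 1" by simp
  ultimately show ?thesis by (metis prime_nat_iff two_is_prime_nat)
qed

lemma add_self: "(x :: 'a) + x = 0"
  using two_eq_0 by (metis mult_2 mult_zero_left)

lemma add_cancel2 [simp]: "(x :: 'a) + (x + y) = y"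
  by (metis add.assoc add_self add_0)

lemma eq_iff_add: "(x :: 'a) = y \<longleftrightarrow> x + y = 0"
  by (metis add_cancel2 add_self add.right_neutral)

lemma frob_add: "(x + y :: 'a) ^ 2 ^ i = x ^ 2 ^ i + y ^ 2 ^ i"
  by (rule freshmans_dream') (use CHAR_2 in auto)

lemma frob_sum: "(\<Sum>j\<in>J. f j :: 'a) ^ 2 ^ i = (\<Sum>j\<in>J. f j ^ 2 ^ i)"
  by (rule freshmans_dream_sum') (use CHAR_2 in auto)

lemma square_add: "(x + y :: 'a) ^ 2 = x ^ 2 + y ^ 2"
  using frob_add[of x y 1] by simp

lemma frob_frob: "((x :: 'a) ^ 2 ^ i) ^ 2 ^ j = x ^ 2 ^ (i + j)"
  by (simp add: power_add power_mult)

lemma frob_comm: "((x :: 'a) ^ 2 ^ i) ^ 2 ^ j = (x ^ 2 ^ j) ^ 2 ^ i"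
  by (simp add: frob_frob add.commute)

lemma square_frob: "((x :: 'a) ^ 2) ^ 2 ^ i = (x ^ 2 ^ i) ^ 2"
  using frob_comm[of x 1 i] by (simp only: power_one_right)

lemma frob_inj: "(x :: 'a) ^ 2 ^ i = y ^ 2 ^ i \<longleftrightarrow> x = y"
proof
  assume "x ^ 2 ^ i = y ^ 2 ^ i"
  hence "(x + y) ^ 2 ^ i = 0" by (simp add: frob_add add_self)
  hence "x + y = 0" by simp
  thus "x = y" by (metis eq_iff_add)
qed auto

lemma frob_surj: "\<exists>y. (y :: 'a) ^ 2 ^ i = x"
proof -
  have "inj (\<lambda>y :: 'a. y ^ 2 ^ i)" by (auto simp: inj_def frob_inj)
  hence "surj (\<lambda>y :: 'a. y ^ 2 ^ i)" by (simp add: finite_UNIV_inj_surj)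
  thus ?thesis by (metis surjD)
qed

section \<open>The subfield F_q, the unit circle and the elements of relative trace 1\<close>

abbreviation Fq :: "'a set" where "Fq \<equiv> GF_sub (2 ^ k)"

definition mu :: "'a set" where "mu = {y. y ^ (2 ^ k + 1) = 1}"

text \<open>The elements of relative trace 1 from F_{q^2} to F_q, since
  \<open>V + V ^ 2 ^ k = 1\<close>; they form one coset of \<open>Fq\<close>.\<close>

definition trace1 :: "'a set" where "trace1 = {V. V ^ 2 ^ k = V + 1}"

lemma Fq_closed:
  "0 \<in> Fq" "1 \<in> Fq" "x \<in> Fq \<Longrightarrow> y \<in> Fq \<Longrightarrow> x + y \<in> Fq" "x \<in> Fq \<Longrightarrow> y \<in> Fq \<Longrightarrow> x * y \<in> Fq"
  "x \<in> Fq \<Longrightarrow> inverse x \<in> Fq" "x \<in> Fq \<Longrightarrow> y \<in> Fq \<Longrightarrow> x / y \<in> Fq" "x \<in> Fq \<Longrightarrow> x ^ n \<in> Fq"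
  by (auto simp: GF_sub_def frob_add power_mult_distrib power_inverse power_divide power_0_left)
     (metis mult.commute power_mult)

lemma Fq_iff: "x \<in> Fq \<longleftrightarrow> x ^ 2 ^ k = x" by (simp add: GF_sub_def)

lemma Fq_frob_iff: "x ^ 2 ^ i \<in> Fq \<longleftrightarrow> x \<in> Fq"
  unfolding Fq_iff by (metis frob_comm frob_inj)

lemma card_Fq: "card Fq = 2 ^ k"
  by (rule card_GF_sub[OF card_field]) (use k0 one_less_power[of "2::nat" k] in auto)

lemma conj_conj: "((x :: 'a) ^ 2 ^ k) ^ 2 ^ k = x"
  using finite_field_power_card_eq_same[of x] card_field by (simp add: power2_eq_square power_mult)

lemma mu_iff: "y \<in> mu \<longleftrightarrow> y \<noteq> 0 \<and> y ^ 2 ^ k = inverse y"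
  unfolding mu_def by (auto simp: power_0_left dest: inverse_unique)

lemma trace1_frob: "V \<in> trace1 \<Longrightarrow> V ^ 2 ^ i \<in> trace1"
  unfolding trace1_def by (auto simp: frob_comm[of V i k] frob_add)

lemma trace1_add_Fq: "V \<in> trace1 \<Longrightarrow> x \<in> Fq \<Longrightarrow> V + x \<in> trace1"
  by (simp add: trace1_def Fq_iff frob_add ac_simps)

lemma trace1_diff: "V \<in> trace1 \<Longrightarrow> W \<in> trace1 \<Longrightarrow> V + W \<in> Fq"
  by (simp add: trace1_def Fq_iff frob_add ac_simps add_self)

lemma trace1_nz: "V \<in> trace1 \<Longrightarrow> V \<noteq> 0 \<and> V + 1 \<noteq> 0"
  using frob_add[of V 1 k] by (auto simp: trace1_def power_0_left add_self)

text \<open>Divide any element outside \<open>Fq\<close> by its relative trace \<open>s\<close>,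
  which is nonzero and lies in \<open>Fq\<close>.\<close>

lemma trace1_ex: "\<exists>V. V \<in> trace1"
proof -
  have "Fq \<noteq> UNIV"
  proof
    assume "Fq = UNIV"
    hence "CARD('a) = 2 ^ k" using card_Fq by simp
    hence "(2 ^ k) ^ 2 = (2 :: nat) ^ k" using card_field by simp
    thus False using k0 by (simp add: power2_eq_square)
  qed
  then obtain x where x: "x \<notin> Fq" by auto
  define s where "s = x + x ^ 2 ^ k"
  have s: "s \<in> Fq" by (simp add: s_def Fq_iff frob_add conj_conj add.commute)
  have s0: "s \<noteq> 0" using x unfolding s_def Fq_iff by (metis eq_iff_add)
  have "x ^ 2 ^ k = x + s" by (simp add: s_def)
  hence "(x / s) ^ 2 ^ k = x / s + 1" using s s0
    by (simp add: Fq_iff power_divide add_divide_distrib)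
  thus ?thesis by (auto simp: trace1_def)
qed

lemma trace1_eq: "V \<in> trace1 \<Longrightarrow> trace1 = (\<lambda>x. V + x) ` Fq"
proof (intro set_eqI iffI)
  fix W assume "V \<in> trace1" "W \<in> trace1"
  thus "W \<in> (\<lambda>x. V + x) ` Fq" by (intro image_eqI[of _ _ "V + W"] trace1_diff) auto
qed (auto intro: trace1_add_Fq)

lemma card_trace1: "card trace1 = 2 ^ k"
proof -
  obtain V where "V \<in> trace1" using trace1_ex by auto
  from trace1_eq[OF this] show ?thesis by (simp add: card_image card_Fq)
qed


subsection \<open>Traces and the equation \<open>V\<^sup>Q + V = c\<close>\<close>

text \<open>For \<open>g\<close> dividing \<open>k\<close> this is the trace from F_q to F_{2^g}; as
  an additive polynomial it is also evaluated outside \<open>Fq\<close>.\<close>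

definition tr :: "nat \<Rightarrow> 'a \<Rightarrow> 'a" where "tr g x = GF_trace (2 ^ g) (k div g) x"

lemma tr_alt: "tr g x = (\<Sum>i<k div g. x ^ 2 ^ (g * i))"
  by (simp add: tr_def GF_trace_def power_mult)

lemma tr_add: "tr g (x + y) = tr g x + tr g y"
  by (simp add: tr_alt frob_add sum.distrib)

lemma tr_0 [simp]: "tr g 0 = 0"
  by (simp add: tr_alt power_0_left)

lemma tr_frob: "tr g (x ^ 2 ^ i) = tr g x ^ 2 ^ i"
  unfolding tr_alt frob_sum by (rule sum.cong) (auto simp: frob_comm)

text \<open>Valid on the whole field: the value is 0 for \<open>x\<close> in \<open>Fq\<close> and 1
  for \<open>x\<close> in \<open>trace1\<close>.\<close>

lemma tr_telescope:
  assumes "g dvd k"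
  shows "tr g (x ^ 2 ^ g + x) = x ^ 2 ^ k + x"
proof -
  have "(\<Sum>i<n. (x ^ 2 ^ g + x) ^ 2 ^ (g * i)) = x ^ 2 ^ (g * n) + x" for n
    by (induction n) (auto simp: frob_add frob_frob add_self ac_simps)
  thus ?thesis using assms by (simp add: tr_alt)
qed

text \<open>The trace lies in F_{2^g}, so it is fixed by the \<open>2 ^ l\<close> Frobenius, with
  which it commutes.\<close>

lemma tr_frob_eq:
  assumes "g dvd k" "g dvd l" "x \<in> Fq"
  shows "tr g (x ^ 2 ^ l) = tr g x"
proof -
  have "tr g x ^ 2 ^ g = tr g x"
    using tr_telescope[OF assms(1), of x] assms(3)
    by (simp add: Fq_iff tr_add tr_frob add_self flip: eq_iff_add)
  hence "tr g x ^ 2 ^ (g * i) = tr g x" for i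
    by (induction i) (auto simp flip: frob_frob)
  thus ?thesis using assms(2) by (auto simp: tr_frob elim!: dvdE)
qed

text \<open>Each further application of the \<open>2 ^ g\<close> Frobenius adds 1 by
  \<open>tr_telescope\<close>, because \<open>V ^ 2 ^ (g * i)\<close> stays in
  \<open>trace1\<close>.\<close>

lemma tr_trace1:
  assumes "g dvd k" "V \<in> trace1"
  shows "tr g (V ^ 2 ^ (g * i) + V) = of_nat i"
proof (induction i)
  case 0
  show ?case by (simp add: add_self)
next
  case (Suc i)
  have "tr g ((V ^ 2 ^ (g * i)) ^ 2 ^ g + V ^ 2 ^ (g * i)) = 1"
    unfolding tr_telescope[OF assms(1)] using trace1_frob[OF assms(2), of "g * i"]
    by (simp add: trace1_def add.commute[of _ 1] add.assoc add_self)
  hence "tr g ((V ^ 2 ^ (g * i)) ^ 2 ^ g + V ^ 2 ^ (g * i)) + tr g (V ^ 2 ^ (g * i) + V) = 1 + of_nat i"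
    using Suc.IH by simp
  thus ?case by (simp add: frob_frob ac_simps flip: tr_add)
qed

lemma of_nat_odd: "odd n \<Longrightarrow> (of_nat n :: 'a) = 1"
  by (elim oddE) (simp add: two_eq_0)

lemma tr_trace1_odd:
  assumes "g dvd k" "g dvd l" "odd (l div g)" "V \<in> trace1"
  shows "tr g (V ^ 2 ^ l + V) = 1"
  using tr_trace1[OF assms(1,4), of "l div g"] assms(2,3) of_nat_odd by simp

text \<open>Transitivity of the trace: the exponents below \<open>d * c\<close> are cut into
  \<open>d\<close> blocks of length \<open>c\<close>.\<close>

lemma tr_trans:
  assumes "m dvd g" "g dvd k"
  shows "tr m x = (\<Sum>j<g div m. tr g x ^ 2 ^ (m * j))"
proof (cases "g = 0")
  case True
  thus ?thesis using assms k0 by auto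
next
  case False
  then obtain c d where c: "g = m * c" "k = g * d" "m > 0" "c > 0"
    using assms by (auto elim!: dvdE)
  have "tr m x = (\<Sum>i<d * c. x ^ 2 ^ (m * i))"
    unfolding tr_alt using c by (simp add: mult.commute)
  also have "\<dots> = (\<Sum>i<d. \<Sum>n\<in>{i * c..<i * c + c}. x ^ 2 ^ (m * n))"
    by (rule sum.nat_group[symmetric])
  also have "\<dots> = (\<Sum>i<d. \<Sum>j<c. x ^ 2 ^ (m * (j + i * c)))"
    using sum.shift_bounds_nat_ivl[of "\<lambda>n. x ^ 2 ^ (m * n)" 0 "i * c" c for i]
    by (simp add: atLeast0LessThan add.commute)
  also have "\<dots> = (\<Sum>j<c. \<Sum>i<d. x ^ 2 ^ (m * (j + i * c)))" by (rule sum.swap)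
  also have "\<dots> = (\<Sum>j<c. tr g x ^ 2 ^ (m * j))"
    unfolding tr_alt using c by (simp add: frob_sum frob_frob algebra_simps)
  finally show ?thesis using c by simp
qed

text \<open>F_{2^k} and F_{2^l} meet in the field belonging to the gcd, by Bezout on the
  exponents.\<close>

lemma frob_fix_gcd:
  assumes "x \<in> Fq" "x ^ 2 ^ l = x" "l > 0"
  shows "x ^ 2 ^ gcd k l = x"
proof -
  obtain s t where st: "l * s = k * t + gcd l k"
    using bezout_nat[of l k] assms(3) by auto
  have *: "x ^ 2 ^ j = x \<Longrightarrow> x ^ 2 ^ (j * i) = x" for i j
    by (induction i) (auto simp flip: frob_frob simp: add.commute[of j])
  have "x = x ^ 2 ^ (l * s)" using *[OF assms(2)] by simp
  also have "\<dots> = x ^ 2 ^ gcd l k" unfolding st frob_frob[symmetric] using assms(1) *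
    by (simp add: Fq_iff)
  finally show ?thesis by (simp add: gcd.commute)
qed

text \<open>The trace minus \<open>c\<close> is a polynomial of degree at most
  \<open>2 ^ (k - g)\<close>, nonzero because its linear coefficient is 1.\<close>

lemma card_tr_eq:
  assumes "g > 0" "g dvd k"
  shows "card {x. tr g x = c} \<le> 2 ^ (k - g)"
proof -
  obtain d where d: "k = g * d" using assms by auto
  have d0: "d > 0" using d k0 by (cases d) auto
  define p where "p = (\<Sum>i<d. monom (1::'a) (2 ^ (g * i))) - [:c:]"
  have "coeff p 1 = (\<Sum>i<d. if i = 0 then 1 else 0)"
    unfolding p_def coeff_diff coeff_sum using assms d0
    by (auto simp: coeff_pCons intro!: sum.cong split: nat.splits)
  hence "p \<noteq> 0" using d0 by auto
  moreover have "degree p \<le> 2 ^ (k - g)"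
  proof -
    have "g * i \<le> k - g" if "i < d" for i
    proof -
      have "g * i \<le> g * (d - 1)" using that by (intro mult_le_mono) auto
      thus ?thesis by (simp add: d diff_mult_distrib2)
    qed
    thus ?thesis unfolding p_def
      by (intro degree_diff_le degree_sum_le order.trans[OF degree_monom_le]) auto
  qed
  moreover have "poly p x = 0" if "x \<in> {x. tr g x = c}" for x
    using that assms(1) unfolding tr_alt by (simp add: p_def poly_sum poly_monom d)
  ultimately show ?thesis by (rule card_le_of_poly_roots)
qed

text \<open>Counting: \<open>f\<close> maps the \<open>2 ^ k\<close> elements of
  \<open>trace1\<close> into \<open>T\<close>, its fibres have at most \<open>2 ^ g\<close>
  elements, and \<open>T\<close> has at most \<open>2 ^ (k - g)\<close>. So the image is all of
  \<open>T\<close>.\<close>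

lemma trace1_solvable:
  assumes l: "l > 0" and odd: "odd (l div gcd k l)" and c: "c \<in> Fq" "tr (gcd k l) c = 1"
  shows "\<exists>V\<in>trace1. V ^ 2 ^ l + V = c"
proof -
  define g where "g = gcd k l"
  have g: "g > 0" "g dvd k" "g dvd l" using k0 by (auto simp: g_def)
  have gk: "g \<le> k" using g k0 by (auto intro: dvd_imp_le)
  define f where "f = (\<lambda>V :: 'a. V ^ 2 ^ l + V)"
  define T where "T = {x. tr g x = 1}"
  have sub: "f ` trace1 \<subseteq> T"
    using tr_trace1_odd[OF g(2,3)] odd by (auto simp: f_def T_def g_def)
  have fib: "card {V \<in> trace1. f V = y} \<le> 2 ^ g" if y: "y \<in> f ` trace1" for y
  proof -
    obtain V where V: "V \<in> trace1" "y = f V" using y by auto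
    \<comment> \<open>Two solutions in \<open>trace1\<close> differ by an element fixed by both
      \<open>2 ^ k\<close> and \<open>2 ^ l\<close>, hence by one of F_{2^g}.\<close>
    have "{W \<in> trace1. f W = y} \<subseteq> (\<lambda>x. V + x) ` GF_sub (2 ^ g)"
    proof
      fix W assume W: "W \<in> {W \<in> trace1. f W = y}"
      define x where "x = V + W"
      have "f W = f V" using W V by simp
      hence "x ^ 2 ^ l + x = 0"
        by (simp add: f_def x_def frob_add ac_simps add_self) (metis add_cancel2 add_self add.left_commute)
      hence "x ^ 2 ^ l = x" by (metis eq_iff_add)
      moreover have "x \<in> Fq" using W V trace1_diff by (auto simp: x_def)
      ultimately have "x ^ 2 ^ g = x" using frob_fix_gcd l by (auto simp: g_def)
      moreover have "W = V + x" by (simp add: x_def)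
      ultimately show "W \<in> (\<lambda>x. V + x) ` GF_sub (2 ^ g)" by (auto simp: GF_sub_def)
    qed
    hence "card {W \<in> trace1. f W = y} \<le> card ((\<lambda>x. V + x) ` GF_sub (2 ^ g))"
      by (intro card_mono) auto
    also have "\<dots> = card (GF_sub (2 ^ g) :: 'a set)" by (simp add: card_image)
    also have "\<dots> = 2 ^ g"
    proof (rule card_GF_sub)
      show "CARD('a) = (2 ^ g) ^ (2 * (k div g))"
        using g by (simp add: card_field mult.left_commute flip: power_mult)
      show "2 * (k div g) > 0" using gk g by (simp add: div_greater_zero_iff)
      show "2 ^ g > (1 :: nat)" using g one_less_power[of "2::nat" g] by simp
    qed
    finally show ?thesis .
  qed
  have "2 ^ g * 2 ^ (k - g) = card trace1" using gk by (simp add: card_trace1 flip: power_add)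
  also have "\<dots> \<le> 2 ^ g * card (f ` trace1)" by (rule card_le_mult_card_image) (use fib in auto)
  finally have "2 ^ (k - g) \<le> card (f ` trace1)" by simp
  moreover have "card T \<le> 2 ^ (k - g)" unfolding T_def by (rule card_tr_eq) (use g in auto)
  ultimately have "f ` trace1 = T" using sub by (intro card_seteq) auto
  moreover have "c \<in> T" using c by (simp add: T_def g_def)
  ultimately show ?thesis by (auto simp: f_def)
qed

lemma tr_1_cases:
  assumes "x \<in> Fq"
  shows "tr 1 x = 0 \<or> tr 1 x = 1"
proof -
  have "tr 1 x ^ 2 = tr 1 x"
    using tr_frob_eq[of 1 1 x] assms by (simp add: tr_frob[of 1 x 1, simplified])
  thus ?thesis by (simp add: power2_eq_square)
qed

lemma tr_1_square: "x \<in> Fq \<Longrightarrow> tr 1 (x ^ 2) = tr 1 x"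
  using tr_frob_eq[of 1 1 x] by simp

lemma trace1_artin_schreier:
  assumes "c \<in> Fq" "tr 1 c = 1"
  shows "\<exists>V\<in>trace1. V ^ 2 + V = c"
  using trace1_solvable[of 1 c] assms by simp


subsection \<open>Reduction to a collision equation on the roots of unity\<close>

lemma mu_nz: "y \<in> mu \<Longrightarrow> y \<noteq> 0" by (simp add: mu_iff)

lemma mu_conj: "y \<in> mu \<Longrightarrow> y ^ 2 ^ k = inverse y" by (simp add: mu_iff)

lemma mu_divide: "y \<in> mu \<Longrightarrow> z \<in> mu \<Longrightarrow> y / z \<in> mu"
  by (simp add: mu_def power_divide)

lemma mu_power: "y \<in> mu \<Longrightarrow> y ^ n \<in> mu"
proof -
  assume "y \<in> mu"
  moreover have "(y ^ n) ^ (2 ^ k + 1) = (y ^ (2 ^ k + 1)) ^ n"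
    unfolding power_mult[symmetric] by (simp add: mult.commute)
  ultimately show ?thesis by (simp only: mu_def mem_Collect_eq power_one)
qed

lemma one_in_mu: "1 \<in> mu" by (simp add: mu_def)

lemma mu_power_cong:
  assumes "y \<in> mu" "[i = j] (mod (2 ^ k + 1))"
  shows "y ^ i = y ^ j"
proof -
  have *: "y ^ n = y ^ (n mod (2 ^ k + 1))" for n
  proof -
    have "y ^ n = y ^ ((2 ^ k + 1) * (n div (2 ^ k + 1)) + n mod (2 ^ k + 1))"
      by (simp only: mult_div_mod_eq)
    also have "\<dots> = (y ^ (2 ^ k + 1)) ^ (n div (2 ^ k + 1)) * y ^ (n mod (2 ^ k + 1))"
      by (simp only: power_add power_mult)
    finally show ?thesis using assms(1) by (simp add: mu_def)
  qed
  show ?thesis using *[of i] *[of j] assms(2) by (simp add: cong_def)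
qed

lemma power_card_minus_1: "(x :: 'a) \<noteq> 0 \<Longrightarrow> x ^ (2 ^ j - 1) = x ^ 2 ^ j / x"
  by (simp add: power_diff)

text \<open>Hilbert 90 for the quadratic extension. The conjugate of \<open>1 + inverse x\<close> is
  \<open>1 + x\<close>, which is \<open>x\<close> times it; only \<open>x = 1\<close> makes this
  witness vanish.\<close>

lemma mu_hilbert90:
  assumes "x \<in> mu"
  shows "\<exists>w. w \<noteq> 0 \<and> w ^ (2 ^ k - 1) = x"
proof (cases "x = 1")
  case True
  thus ?thesis by (intro exI[of _ 1]) auto
next
  case False
  have x: "x \<noteq> 0" "x ^ 2 ^ k = inverse x" using assms by (auto simp: mu_iff)
  define w where "w = 1 + inverse x"
  have "w \<noteq> 0" using False x by (simp add: w_def flip: eq_iff_add)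
  moreover have "w ^ 2 ^ k = x * w" using x by (simp add: w_def frob_add power_inverse algebra_simps)
  ultimately show ?thesis by (intro exI[of _ w]) (simp add: power_card_minus_1 del: One_nat_def)
qed

text \<open>Coprimality of \<open>Q - 1\<close> and \<open>q + 1\<close> makes the kernel on
  \<open>mu\<close> trivial; this justifies substituting \<open>y ^ (Q - 1)\<close> for a point of
  \<open>mu\<close>.\<close>

lemma mu_power_bij:
  assumes "l > 0" "gcd (2 ^ l - 1) (2 ^ k + 1) = (1 :: nat)"
  shows "bij_betw (\<lambda>y. y ^ (2 ^ l - 1)) mu mu"
proof -
  have ne: "2 ^ l - 1 \<noteq> (0 :: nat)" using one_less_power[of "2::nat" l] assms(1) by simp
  obtain s t where st: "(2 ^ l - 1) * s = (2 ^ k + 1) * t + (1 :: nat)"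
    using bezout_nat[OF ne, of "2 ^ k + 1"] assms(2) by auto
  have one: "x = 1" if x: "x \<in> mu" "x ^ (2 ^ l - 1) = 1" for x
  proof -
    have "1 = x ^ ((2 ^ l - 1) * s)" unfolding power_mult x(2) by simp
    also have "\<dots> = (x ^ (2 ^ k + 1)) ^ t * x" unfolding st power_add power_mult power_one_right ..
    also have "\<dots> = x" using x(1) by (simp only: mu_def mem_Collect_eq power_one mult_1_left)
    finally show ?thesis by simp
  qed
  have inj: "inj_on (\<lambda>y. y ^ (2 ^ l - 1)) mu"
  proof (rule inj_onI)
    fix y z assume yz: "y \<in> mu" "z \<in> mu" "y ^ (2 ^ l - 1) = z ^ (2 ^ l - 1)"
    hence "(y / z) ^ (2 ^ l - 1) = 1" using mu_nz[of z] by (simp add: power_divide)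
    hence "y / z = 1" using one mu_divide yz by blast
    thus "y = z" using yz mu_nz by simp
  qed
  moreover have "(\<lambda>y. y ^ (2 ^ l - 1)) ` mu \<subseteq> mu" using mu_power by auto
  ultimately have "(\<lambda>y. y ^ (2 ^ l - 1)) ` mu = mu" by (intro endo_inj_surj) auto
  thus ?thesis using inj by (simp add: bij_betw_def)
qed

text \<open>Solving \<open>V = y / (y + z)\<close> for \<open>z\<close>: the points of
  \<open>mu\<close> other than \<open>y\<close> are parametrised by \<open>trace1\<close>.\<close>

lemma mu_param:
  assumes "y \<in> mu" "V \<in> trace1"
  shows "y * (V + 1) / V \<in> mu" "y * (V + 1) / V \<noteq> y"
proof -
  have V: "V \<noteq> 0" "V + 1 \<noteq> 0" using trace1_nz assms(2) by auto
  show "y * (V + 1) / V \<in> mu" using assms V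
    by (auto simp: mu_iff power_mult_distrib power_divide frob_add trace1_def add.assoc add_self
          inverse_eq_divide)
  show "y * (V + 1) / V \<noteq> y" using V mu_nz[OF assms(1)] by (auto simp: field_simps)
qed

lemma mu_param_surj:
  assumes "y \<in> mu" "z \<in> mu" "z \<noteq> y"
  shows "\<exists>V\<in>trace1. z = y * (V + 1) / V"
proof
  have nz: "y \<noteq> 0" "z \<noteq> 0" "y + z \<noteq> 0" using assms mu_nz by (auto simp flip: eq_iff_add)
  define V where "V = y / (y + z)"
  have "V + 1 = z / (y + z)" using nz by (simp add: V_def field_simps add_self)
  thus "z = y * (y / (y + z) + 1) / (y / (y + z))" using nz by (simp add: V_def)
  have "inverse y / (inverse y + inverse z) = z / (y + z)" using nz by (simp add: field_simps)
  hence "V ^ 2 ^ k = V + 1" unfolding \<open>V + 1 = _\<close>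
    using assms by (simp add: V_def power_divide frob_add mu_conj)
  thus "y / (y + z) \<in> trace1" by (simp add: trace1_def V_def)
qed

section \<open>Numerator and denominator of the induced map on the unit circle\<close>

definition hden :: "nat \<Rightarrow> 'a \<Rightarrow> 'a \<Rightarrow> 'a \<Rightarrow> 'a" where
  "hden l a d y = a * (y ^ 2 ^ l * y) + y + d"

definition hnum :: "nat \<Rightarrow> 'a \<Rightarrow> 'a \<Rightarrow> 'a \<Rightarrow> 'a" where
  "hnum l a d y = d * (y ^ 2 ^ l * y) + y ^ 2 ^ l + a"

text \<open>Conjugation inverts \<open>y\<close> and fixes \<open>a\<close> and \<open>d\<close>, so
  it reverses the coefficients. In particular \<open>hnum\<close> vanishes wherever
  \<open>hden\<close> does.\<close>

lemma hnum_conj: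
  assumes "a \<in> Fq" "d \<in> Fq" "y \<in> mu"
  shows "hnum l a d y = y ^ 2 ^ l * y * hden l a d y ^ 2 ^ k"
proof -
  have y: "y \<noteq> 0" "y ^ 2 ^ k = inverse y" using assms mu_iff by auto
  have "(y ^ 2 ^ l) ^ 2 ^ k = inverse (y ^ 2 ^ l)"
    unfolding frob_comm[of y l k] y by (simp add: power_inverse)
  thus ?thesis using assms(1,2) y
    by (simp add: hnum_def hden_def frob_add power_mult_distrib Fq_iff field_simps)
qed

text \<open>Cross-multiplied injectivity of \<open>hnum / hden\<close> on \<open>mu\<close>. A zero
  of \<open>hden\<close> is also one of \<open>hnum\<close> and so collides with every other point;
  hence the right side also excludes zeros of \<open>A\<close> on \<open>mu\<close>.\<close>

lemma perm_iff:
  assumes l: "l > 0" and gcd1: "gcd (2 ^ l - 1) (2 ^ k + 1) = (1 :: nat)"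
    and ad: "a \<in> Fq" "d \<in> Fq"
    and u: "u > 0" "[u * (2 ^ l - 1) = 2 ^ l] (mod (2 ^ k + 1))"
    and v: "v > 0" "[v * (2 ^ l - 1) = 2 ^ k] (mod (2 ^ k + 1))"
    and A: "A = 1 + monom a u + monom d v"
    and f: "f = monom 1 1 * pcompose A (monom 1 (2 ^ k - 1))"
  shows "bij (poly f) \<longleftrightarrow>
    (\<forall>y\<in>mu. \<forall>z\<in>mu. y \<noteq> z \<longrightarrow> hnum l a d y * hden l a d z \<noteq> hnum l a d z * hden l a d y)"
    (is "_ = ?R")
proof -
  let ?D = "hden l a d" and ?N = "hnum l a d"
  have f_eq: "poly f w = w * poly A (w ^ (2 ^ k - 1))" for w
    by (simp add: f poly_pcompose poly_monom)
  have bij: "bij_betw (\<lambda>y. y ^ (2 ^ l - 1)) mu mu" by (rule mu_power_bij[OF l gcd1])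
  \<comment> \<open>The congruences for \<open>u\<close> and \<open>v\<close> turn the two powers
    into \<open>y ^ Q\<close> and \<open>y ^ q\<close>, the latter being
    \<open>inverse y\<close>.\<close>
  have AD: "poly A (y ^ (2 ^ l - 1)) = ?D y / y" if "y \<in> mu" for y
  proof -
    have "(y ^ (2 ^ l - 1)) ^ u = y ^ 2 ^ l"
      using mu_power_cong[OF that u(2)] by (simp add: mult.commute flip: power_mult)
    moreover have "(y ^ (2 ^ l - 1)) ^ v = inverse y"
      using mu_power_cong[OF that v(2)] mu_conj[OF that] by (simp add: mult.commute flip: power_mult)
    ultimately show ?thesis using mu_nz[OF that]
      by (simp add: A poly_monom hden_def field_simps)
  qed
  have f_D: "poly f w = w * ?D y / y" if "y \<in> mu" "w ^ (2 ^ k - 1) = y ^ (2 ^ l - 1)" for w y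
    unfolding f_eq that(2) AD[OF that(1)] by simp
  \<comment> \<open>The \<open>q - 1\<close> power map carries \<open>f\<close> to the fraction
    \<open>?N / ?D\<close> in the variable \<open>y\<close>.\<close>
  have f_quot: "poly f w ^ (2 ^ k - 1) = ?N y / ?D y"
    if y: "y \<in> mu" "w ^ (2 ^ k - 1) = y ^ (2 ^ l - 1)" and nz: "w \<noteq> 0" "?D y \<noteq> 0" for w y
  proof -
    have "poly f w ^ (2 ^ k - 1) = w ^ (2 ^ k - 1) * ?D y ^ (2 ^ k - 1) / y ^ (2 ^ k - 1)"
      unfolding f_D[OF y] by (simp add: power_mult_distrib power_divide)
    also have "\<dots> = y ^ 2 ^ l / y * (?D y ^ 2 ^ k / ?D y) / (inverse y / y)"
      unfolding y(2) using mu_nz[OF y(1)] mu_conj[OF y(1)] nz by (simp add: power_card_minus_1 del: One_nat_def)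
    also have "\<dots> = ?N y / ?D y"
      unfolding hnum_conj[OF ad y(1)] using mu_nz[OF y(1)] nz by (simp add: field_simps)
    finally show ?thesis .
  qed
  show ?thesis
  proof (intro iffI ballI impI)
    fix y z assume "bij (poly f)" and yz: "y \<in> mu" "z \<in> mu" "y \<noteq> z"
    hence inj: "\<And>w w'. poly f w = poly f w' \<Longrightarrow> w = w'" by (auto simp: bij_def inj_def)
    have ex: "\<exists>w. w \<noteq> 0 \<and> w ^ (2 ^ k - 1) = x ^ (2 ^ l - 1) \<and> ?D x \<noteq> 0" if x: "x \<in> mu" for x
    proof -
      obtain w where w: "w \<noteq> 0" "w ^ (2 ^ k - 1) = x ^ (2 ^ l - 1)"
        using mu_hilbert90[OF mu_power[OF x]] by blast
      have "?D x \<noteq> 0"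
      proof
        assume "?D x = 0"
        hence "poly f w = poly f 0" using f_D[OF x w(2)] by (simp add: f_eq)
        thus False using inj w by auto
      qed
      thus ?thesis using w by auto
    qed
    obtain w where w: "w \<noteq> 0" "w ^ (2 ^ k - 1) = y ^ (2 ^ l - 1)" "?D y \<noteq> 0" using ex yz by blast
    obtain w' where w': "w' \<noteq> 0" "w' ^ (2 ^ k - 1) = z ^ (2 ^ l - 1)" "?D z \<noteq> 0" using ex yz by blast
    show "?N y * ?D z \<noteq> ?N z * ?D y"
    proof
      assume "?N y * ?D z = ?N z * ?D y"
      hence "?N y / ?D y = ?N z / ?D z" using w w' by (simp add: field_simps)
      hence eq: "poly f w ^ (2 ^ k - 1) = poly f w' ^ (2 ^ k - 1)"
        using f_quot yz w w' by simp
      have nz: "poly f w \<noteq> 0" "poly f w' \<noteq> 0"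
        using inj[of w 0] inj[of w' 0] w w' by (auto simp: f_eq)
      \<comment> \<open>\<open>f\<close> commutes with scaling by any \<open>c\<close> with
        \<open>c ^ (q - 1) = 1\<close>. Equal \<open>q - 1\<close> powers of two values therefore
        make \<open>w\<close> a multiple of \<open>w'\<close> by such a scalar.\<close>
      define c where "c = poly f w / poly f w'"
      have c: "c ^ (2 ^ k - 1) = 1" using eq nz by (simp add: c_def power_divide)
      have "poly f (c * w') = c * poly f w'" by (simp add: f_eq power_mult_distrib c del: One_nat_def)
      also have "\<dots> = poly f w" using nz by (simp add: c_def)
      finally have "w = c * w'" using inj by metis
      hence "y ^ (2 ^ l - 1) = z ^ (2 ^ l - 1)" using w w' by (simp add: power_mult_distrib c del: One_nat_def)
      thus False using bij yz by (auto simp: bij_betw_def inj_on_def)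
    qed
  next
    assume R: ?R
    have D0: "?D y \<noteq> 0" if y: "y \<in> mu" for y
    proof
      assume "?D y = 0"
      moreover from this have "?N y = 0" using hnum_conj[OF ad y] by (simp add: power_0_left)
      moreover obtain V where "V \<in> trace1" using trace1_ex by auto
      ultimately show False using R y mu_param[OF y] by (metis mult_zero_left mult_zero_right)
    qed
    have ex: "\<exists>y\<in>mu. w ^ (2 ^ k - 1) = y ^ (2 ^ l - 1)" if "w \<noteq> 0" for w
    proof -
      have "w ^ (2 ^ k - 1) \<in> mu" using that conj_conj[of w]
        by (simp add: mu_iff power_card_minus_1 power_divide del: One_nat_def)
      thus ?thesis using bij by (auto simp: bij_betw_def)
    qed
    have nz: "poly f w \<noteq> 0" if w: "w \<noteq> 0" for w
    proof -
      from ex[OF w] obtain y where y: "y \<in> mu" "w ^ (2 ^ k - 1) = y ^ (2 ^ l - 1)" by blast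
      show ?thesis using f_D[OF y] D0[OF y(1)] mu_nz[OF y(1)] w by simp
    qed
    have "inj (poly f)"
    proof (rule injI)
      fix w w' assume eq: "poly f w = poly f w'"
      show "w = w'"
      proof (cases "w = 0 \<or> w' = 0")
        case True
        moreover have "poly f 0 = 0" by (simp add: f_eq)
        ultimately show ?thesis using nz eq by metis
      next
        case False
        then obtain y z where y: "y \<in> mu" "w ^ (2 ^ k - 1) = y ^ (2 ^ l - 1)"
          and z: "z \<in> mu" "w' ^ (2 ^ k - 1) = z ^ (2 ^ l - 1)" using ex by metis
        have "?N y / ?D y = ?N z / ?D z"
          using f_quot[OF y] f_quot[OF z] D0 y z False eq by metis
        hence "y = z" using R y z D0 by (auto simp: field_simps)
        thus ?thesis using f_D[OF y] f_D[OF z] eq D0 y(1) mu_nz by simp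
      qed
    qed
    thus "bij (poly f)" by (simp add: bij_def finite_UNIV_inj_surj)
  qed
qed

text \<open>Coordinates \<open>V = y / (y + z)\<close>, \<open>U = (1 + y z) / (y + z)\<close> of a pair \<open>(y, z)\<close>.\<close>

definition Upar :: "'a \<Rightarrow> 'a \<Rightarrow> 'a" where "Upar y V = y * V + V / y + y"

lemma Upar_Fq: "y \<in> mu \<Longrightarrow> V \<in> trace1 \<Longrightarrow> Upar y V \<in> Fq"
  by (simp add: Upar_def Fq_iff frob_add power_mult_distrib power_divide mu_conj trace1_def)
     (simp add: inverse_eq_divide add_divide_distrib distrib_left add_self ac_simps)

definition collision :: "nat \<Rightarrow> 'a \<Rightarrow> 'a \<Rightarrow> 'a \<Rightarrow> 'a \<Rightarrow> 'a" where
  "collision l a d U V =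
     (1 + a ^ 2 + d ^ 2) * (V ^ 2 ^ l + V + 1) + a * U ^ 2 ^ l + d * U + 1"

text \<open>A rational identity in characteristic 2, in which \<open>Y\<close> and \<open>W\<close>,
  the \<open>Q\<close>-th powers of \<open>y\<close> and \<open>V\<close>, are treated as
  independent quantities.\<close>

lemma collision_eq:
  assumes "y \<in> mu" "V \<in> trace1"
  defines "z \<equiv> y * (V + 1) / V"
  shows "hnum l a d y * hden l a d z + hnum l a d z * hden l a d y =
    (y ^ 2 ^ l * y) / (V ^ 2 ^ l * V) * collision l a d (Upar y V) V"
proof -
  define Y where "Y = y ^ 2 ^ l"
  define W where "W = V ^ 2 ^ l"
  have nz: "y \<noteq> 0" "V \<noteq> 0" "Y \<noteq> 0" "W \<noteq> 0" using assms mu_nz trace1_nz by (auto simp: Y_def W_def)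
  have 1: "z ^ 2 ^ l = Y * (W + 1) / W"
    by (simp add: z_def power_divide power_mult_distrib frob_add Y_def W_def)
  have 2: "Upar y V ^ 2 ^ l = Y * W + W / Y + Y"
    by (simp add: Upar_def power_divide power_mult_distrib frob_add Y_def W_def)
  have "(hnum l a d y * hden l a d z + hnum l a d z * hden l a d y) * (W * V) =
     (Y * y) * collision l a d (Upar y V) V"
    unfolding hnum_def hden_def collision_def 1 2 Y_def[symmetric] W_def[symmetric]
    unfolding z_def Upar_def
    by (subst eq_iff_add) (use nz in \<open>simp add: field_simps power2_eq_square add_self\<close>)
  thus ?thesis unfolding Y_def W_def using nz by (simp add: field_simps Y_def W_def)
qed

lemma perm_iff_collision:
  assumes l: "l > 0" and gcd1: "gcd (2 ^ l - 1) (2 ^ k + 1) = (1 :: nat)"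
    and ad: "a \<in> Fq" "d \<in> Fq"
    and u: "u > 0" "[u * (2 ^ l - 1) = 2 ^ l] (mod (2 ^ k + 1))"
    and v: "v > 0" "[v * (2 ^ l - 1) = 2 ^ k] (mod (2 ^ k + 1))"
    and A: "A = 1 + monom a u + monom d v"
    and f: "f = monom 1 1 * pcompose A (monom 1 (2 ^ k - 1))"
  shows "bij (poly f) \<longleftrightarrow> (\<forall>y\<in>mu. \<forall>V\<in>trace1. collision l a d (Upar y V) V \<noteq> 0)"
proof -
  have *: "hnum l a d y * hden l a d (y * (V + 1) / V) = hnum l a d (y * (V + 1) / V) * hden l a d y
    \<longleftrightarrow> collision l a d (Upar y V) V = 0" if "y \<in> mu" "V \<in> trace1" for y V
    using collision_eq[OF that, of l a d] mu_nz[OF that(1)] trace1_nz[OF that(2)]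
    by (subst eq_iff_add) simp
  show ?thesis unfolding perm_iff[OF assms]
  proof (intro iffI ballI impI)
    fix y V assume "\<forall>y\<in>mu. \<forall>z\<in>mu. y \<noteq> z \<longrightarrow> hnum l a d y * hden l a d z \<noteq> hnum l a d z * hden l a d y"
      and yV: "y \<in> mu" "V \<in> trace1"
    thus "collision l a d (Upar y V) V \<noteq> 0"
      using *[OF yV] mu_param[OF yV] by metis
  next
    fix y z assume "\<forall>y\<in>mu. \<forall>V\<in>trace1. collision l a d (Upar y V) V \<noteq> 0"
      "y \<in> mu" "z \<in> mu" "y \<noteq> z"
    thus "hnum l a d y * hden l a d z \<noteq> hnum l a d z * hden l a d y"
      using * mu_param_surj[of y z] by metis
  qed
qed


section \<open>Normal form of the collision equation and its solvability in each coordinate\<close>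

definition psi :: "nat \<Rightarrow> 'a \<Rightarrow> 'a \<Rightarrow> 'a \<Rightarrow> 'a \<Rightarrow> 'a \<Rightarrow> 'a" where
  "psi l \<alpha> \<beta> c U V = V ^ 2 ^ l + V + (\<alpha> * U) ^ 2 ^ l + \<beta> * U + c"

lemma collision_psi:
  assumes "1 + a ^ 2 + d ^ 2 \<noteq> 0" "\<alpha> ^ 2 ^ l = a / (1 + a ^ 2 + d ^ 2)"
  shows "collision l a d U V = (1 + a ^ 2 + d ^ 2) *
    psi l \<alpha> (d / (1 + a ^ 2 + d ^ 2)) (1 + 1 / (1 + a ^ 2 + d ^ 2)) U V"
proof -
  define e where "e = 1 + a ^ 2 + d ^ 2"
  have "e \<noteq> 0" "\<alpha> ^ 2 ^ l = a / e" using assms by (simp_all add: e_def)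
  thus ?thesis unfolding collision_def psi_def power_mult_distrib e_def[symmetric]
    by (simp add: field_simps)
qed

text \<open>The 1 comes from \<open>V\<close>, and \<open>(\<alpha> * U) ^ 2 ^ l\<close> has the
  same trace as \<open>\<alpha> * U\<close>. For \<open>\<alpha> = \<beta>\<close> the trace no
  longer depends on \<open>U\<close> and \<open>V\<close>.\<close>

lemma tr_psi:
  assumes g: "g dvd k" "g dvd l" "odd (l div g)" and V: "V \<in> trace1"
    and \<alpha>: "\<alpha> \<in> Fq" and U: "U \<in> Fq"
  shows "tr g (psi l \<alpha> \<beta> c U V) = 1 + tr g ((\<alpha> + \<beta>) * U) + tr g c"
  unfolding psi_def tr_add tr_frob_eq[OF g(1,2) Fq_closed(4)[OF \<alpha> U]] distrib_right
  using tr_trace1_odd[OF g V] by (simp add: tr_add add.assoc)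

text \<open>\<open>Upar y V = 0\<close> amounts to \<open>y ^ 2 = V / (V + 1)\<close>, and the
  square root has norm 1 because \<open>V / (V + 1)\<close> does. This makes \<open>U = 0\<close>
  available for every \<open>V\<close>.\<close>

lemma mu_sqrt:
  assumes "V \<in> trace1"
  shows "\<exists>y\<in>mu. Upar y V = 0"
proof -
  have V: "V \<noteq> 0" "V + 1 \<noteq> 0" using trace1_nz assms by auto
  obtain y where y: "y ^ 2 = V / (V + 1)" using frob_surj[of 1 "V / (V + 1)"] by auto
  have y0: "y \<noteq> 0" using y V by auto
  have "(y * y ^ 2 ^ k) ^ 2 = y ^ 2 * (y ^ 2) ^ 2 ^ k" by (simp add: power_mult_distrib square_frob)
  also have "\<dots> = 1" unfolding y
    using V assms by (simp add: power_divide frob_add trace1_def add.assoc add_self)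
  finally have "y * y ^ 2 ^ k = 1" using frob_inj[of "y * y ^ 2 ^ k" 1 1] by simp
  hence "y \<in> mu" by (simp add: mu_def)
  moreover have "Upar y V = (y ^ 2 * (V + 1) + V) / y"
    using y0 by (simp add: Upar_def field_simps power2_eq_square)
  hence "Upar y V = 0" using y V add_self by simp
  ultimately show ?thesis by blast
qed

text \<open>\<open>Upar y V = U\<close> is a quadratic in \<open>y\<close>. Substituting
  \<open>y = Y * U / (V + 1)\<close> gives the Artin-Schreier equation
  \<open>Y ^ 2 + Y = (V ^ 2 + V) / U ^ 2\<close>, and a root in \<open>trace1\<close> puts
  \<open>y\<close> into \<open>mu\<close>.\<close>

lemma Upar_solvable:
  assumes V: "V \<in> trace1" and U: "U \<in> Fq" "U \<noteq> 0" and tr1: "tr 1 ((V ^ 2 + V) / U ^ 2) = 1"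
  shows "\<exists>y\<in>mu. Upar y V = U"
proof -
  have V': "V \<noteq> 0" "V + 1 \<noteq> 0" "V ^ 2 ^ k = V + 1" using trace1_nz V by (auto simp: trace1_def)
  have "(V ^ 2 + V) ^ 2 ^ k = V ^ 2 + V"
    using V'(3) by (simp add: frob_add square_add square_frob ac_simps)
  hence "(V ^ 2 + V) / U ^ 2 \<in> Fq" using U(1) Fq_closed(6,7) Fq_iff by blast
  then obtain Y where Y: "Y \<in> trace1" "Y ^ 2 + Y = (V ^ 2 + V) / U ^ 2"
    using trace1_artin_schreier tr1 by blast
  have Y': "Y \<noteq> 0" "Y + 1 \<noteq> 0" "Y ^ 2 ^ k = Y + 1" using trace1_nz Y by (auto simp: trace1_def)
  define y where "y = Y * U / (V + 1)"
  have YV: "Y * (Y + 1) * U ^ 2 = V * (V + 1)"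
    using Y(2) U by (simp add: field_simps power2_eq_square)
  have y0: "y \<noteq> 0" using Y' U V' by (simp add: y_def)
  have "y ^ 2 ^ k = (Y + 1) * U / V"
    using U(1) V' Y' by (simp add: y_def power_divide power_mult_distrib frob_add Fq_iff add.assoc add_self)
  hence "y * y ^ 2 ^ k = Y * (Y + 1) * U ^ 2 / (V * (V + 1))"
    by (simp add: y_def power2_eq_square ac_simps)
  hence "y * y ^ 2 ^ k = 1" unfolding YV using V' by simp
  hence ymu: "y \<in> mu" by (simp add: mu_def)
  have "y ^ 2 * (V + 1) = Y ^ 2 * U ^ 2 / (V + 1)"
    using V'(2) by (simp add: y_def power_divide power_mult_distrib power2_eq_square[of "V + 1"])
  moreover have "Y ^ 2 * U ^ 2 = V * (V + 1) + Y * U ^ 2"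
    unfolding YV[symmetric] by (simp add: algebra_simps power2_eq_square add_self)
  moreover have "U * y = Y * U ^ 2 / (V + 1)" by (simp add: y_def power2_eq_square)
  ultimately have "y ^ 2 * (V + 1) + V = U * y"
    using V' by (simp add: add_divide_distrib add_self ac_simps)
  moreover have "Upar y V = (y ^ 2 * (V + 1) + V) / y"
    using y0 by (simp add: Upar_def field_simps power2_eq_square)
  ultimately have "Upar y V = U" using y0 by simp
  thus ?thesis using ymu by blast
qed

lemma Upar_add: "Upar y (V + x) = Upar y V + x * (y + inverse y)"
  by (simp add: Upar_def algebra_simps add_divide_distrib divide_inverse)

text \<open>For fixed \<open>y\<close> the collision equation is affine in \<open>V\<close>, so it can only be insoluble if its
  linear part is singular.\<close>

lemma psi_singular:
  assumes y: "y \<in> mu" and ab: "\<alpha> \<in> Fq" "\<beta> \<in> Fq" "c \<in> Fq"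
    and no: "\<And>V. V \<in> trace1 \<Longrightarrow> psi l \<alpha> \<beta> c (Upar y V) V \<noteq> 0"
  shows "\<exists>x\<in>Fq. x \<noteq> 0 \<and>
    (x * (1 + \<alpha> * (y + inverse y))) ^ 2 ^ l = x * (1 + \<beta> * (y + inverse y))"
proof (rule ccontr)
  assume neg: "\<not> ?thesis"
  define t where "t = y + inverse y"
  \<comment> \<open>\<open>L x\<close> is the change of \<open>psi\<close> when \<open>V\<close>
    moves to \<open>V + x\<close>, since \<open>Upar\<close> then moves by
    \<open>x * t\<close>.\<close>
  define L where "L = (\<lambda>x. (x * (1 + \<alpha> * t)) ^ 2 ^ l + x * (1 + \<beta> * t))"
  have t: "t \<in> Fq" using mu_conj[OF y] by (simp add: t_def Fq_iff frob_add power_inverse add.commute)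
  have L_add: "L (x + x') = L x + L x'" for x x'
    by (simp add: L_def distrib_right frob_add ac_simps)
  have "inj_on L Fq"
  proof (rule inj_onI)
    fix x x' assume x: "x \<in> Fq" "x' \<in> Fq" "L x = L x'"
    hence "L (x + x') = 0" by (simp add: L_add add_self)
    hence "((x + x') * (1 + \<alpha> * t)) ^ 2 ^ l = (x + x') * (1 + \<beta> * t)"
      unfolding L_def by (subst eq_iff_add)
    moreover have "x + x' \<in> Fq" using x Fq_closed by auto
    ultimately have "x + x' = 0" using neg unfolding t_def by blast
    thus "x = x'" by (metis eq_iff_add)
  qed
  moreover have "L ` Fq \<subseteq> Fq" using Fq_closed ab t by (auto simp: L_def)
  ultimately have surj: "L ` Fq = Fq" by (intro endo_inj_surj) auto
  obtain V where V: "V \<in> trace1" using trace1_ex by auto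
  have "V ^ 2 ^ l + V \<in> Fq" using V trace1_frob trace1_diff by auto
  hence "psi l \<alpha> \<beta> c (Upar y V) V \<in> Fq"
    unfolding psi_def using Fq_closed ab Upar_Fq[OF y V] by auto
  then obtain x where x: "x \<in> Fq" "L x = psi l \<alpha> \<beta> c (Upar y V) V" using surj by (metis imageE)
  have "psi l \<alpha> \<beta> c (Upar y (V + x)) (V + x) = psi l \<alpha> \<beta> c (Upar y V) V + L x"
    unfolding Upar_add t_def[symmetric]
    by (simp add: psi_def L_def distrib_left distrib_right frob_add ac_simps)
  hence "psi l \<alpha> \<beta> c (Upar y (V + x)) (V + x) = 0" by (simp add: x add_self)
  thus False using no trace1_add_Fq[OF V x(1)] by blast
qed

text \<open>\<open>(V + 1) / V\<close> runs through points of \<open>mu\<close> other than 1; this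
  lower bound suffices for the degree comparison below.\<close>

lemma card_mu: "2 ^ k \<le> card mu"
proof -
  have "inj_on (\<lambda>V. 1 * (V + 1) / V) trace1"
    using trace1_nz by (auto simp: inj_on_def field_simps)
  hence "card ((\<lambda>V. 1 * (V + 1) / V) ` trace1) = 2 ^ k" by (simp add: card_image card_trace1)
  moreover have "(\<lambda>V. 1 * (V + 1) / V) ` trace1 \<subseteq> mu" using mu_param(1)[OF one_in_mu] by blast
  ultimately show ?thesis by (metis card_mono finite)
qed

text \<open>A value \<open>t\<close> is taken only at roots of \<open>Y ^ 2 + t * Y + 1\<close>, so
  at most twice.\<close>

lemma card_mu_trace: "2 ^ k \<le> 2 * card ((\<lambda>y. y + inverse y) ` mu)"
proof -
  have "card {y \<in> mu. y + inverse y = t} \<le> 2" for t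
  proof (rule card_le_of_poly_roots)
    show "[:1, t, 1:] \<noteq> 0" "degree [:1, t, 1:] \<le> 2" by auto
    fix y assume "y \<in> {y \<in> mu. y + inverse y = t}"
    hence "y \<noteq> 0" "y + inverse y = t" using mu_nz by auto
    hence "t * y = y * y + 1" by (auto simp: field_simps)
    thus "poly [:1, t, 1:] y = 0" by (simp add: algebra_simps add_self)
  qed
  hence "card mu \<le> 2 * card ((\<lambda>y. y + inverse y) ` mu)"
    by (intro card_le_mult_card_image) auto
  thus ?thesis using card_mu by linarith
qed

end

subsection \<open>Sums of powers of two modulo \<open>2\<^sup>k - 1\<close>\<close>

lemma two_plus_power_eq_power:
  assumes "2 + 2 ^ z = (2 :: nat) ^ x"
  shows "z = 1 \<and> x = 2"
proof -
  have x: "x \<ge> 2"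
  proof (rule ccontr)
    assume "\<not> x \<ge> 2"
    hence "x = 0 \<or> x = 1" by auto
    thus False using assms by auto
  qed
  then obtain x' where x': "x = x' + 2" by (metis add.commute le_Suc_ex)
  have "z < 2"
  proof (rule ccontr)
    assume "\<not> z < 2"
    then obtain z' where "z = z' + 2" by (metis add.commute le_Suc_ex not_less)
    hence "2 + 4 * 2 ^ z' = (4 :: nat) * 2 ^ x'" using assms x' by simp
    thus False by presburger
  qed
  moreover have "z \<noteq> 0"
  proof
    assume "z = 0"
    hence "3 = (4 :: nat) * 2 ^ x'" using assms x' by simp
    thus False by presburger
  qed
  ultimately have "z = 1" by simp
  moreover from this have "(2::nat) ^ x = 2 ^ 2" using assms by simp
  hence "x = 2" by (rule power_inject_exp[THEN iffD1, rotated]) simp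
  ultimately show ?thesis by simp
qed

text \<open>Meant for \<open>N = 2 ^ k\<close>: the bounds allow at most one wrap-around, so
  \<open>a - b\<close> is 0 or \<open>N - 1\<close>.\<close>

lemma cong_minus_1_cases:
  assumes "[a = b] (mod (N - 1))" "a \<ge> 1" "b \<ge> 1" "a \<le> N + 1" "b < N - 1" "N \<ge> (4 :: nat)"
  shows "a = b \<or> a + 1 = b + N"
proof -
  have "int (N - 1) dvd int a - int b"
    using assms(1) by (metis cong_int_iff cong_iff_dvd_diff)
  then obtain c where c: "int a - int b = (int N - 1) * c" using assms(6) by (auto simp: of_nat_diff)
  have b: "int b < int N - 1" "int b \<ge> 1" "int a \<le> int N + 1" "int N \<ge> 4"
    using assms(3-6) by linarith+
  have "c > - 1"
  proof (rule ccontr)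
    assume "\<not> c > - 1"
    hence "(int N - 1) * c \<le> - (int N - 1)"
      using mult_left_mono[of c "- 1" "int N - 1"] assms(6) by simp
    thus False using c b by linarith
  qed
  moreover have "c < 2"
  proof (rule ccontr)
    assume "\<not> c < 2"
    hence "(int N - 1) * c \<ge> 2 * int N - 2"
      using mult_left_mono[of 2 c "int N - 1"] assms(6) by simp
    thus False using c b by linarith
  qed
  ultimately have "c = 0 \<or> c = 1" by auto
  thus ?thesis using c by auto
qed

lemma power_2_plus_1_cong:
  assumes "k \<ge> 2" "s < k" "x < k"
  shows "[2 ^ s + 1 = (2 :: nat) ^ x] (mod (2 ^ k - 1)) \<longleftrightarrow> s = 0 \<and> x = 1"
proof
  assume cong: "[2 ^ s + 1 = 2 ^ x] (mod (2 ^ k - 1 :: nat))"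
  obtain j where j: "k = j + 2" using assms(1) by (metis add.commute le_Suc_ex)
  have N: "(2 :: nat) ^ k = 4 * 2 ^ j" "(2 :: nat) ^ (j + 1) = 2 * 2 ^ j" "(1 :: nat) \<le> 2 ^ x"
    by (simp_all add: j)
  have le: "(2 :: nat) ^ s \<le> 2 ^ (j + 1)" "(2 :: nat) ^ x \<le> 2 ^ (j + 1)" "(1::nat) \<le> 2 ^ j"
    using assms j power_increasing[of _ "j + 1" "2 :: nat"] by auto
  have "2 ^ s + 1 = (2::nat) ^ x \<or> 2 ^ s + 1 + 1 = (2::nat) ^ x + 2 ^ k"
    by (rule cong_minus_1_cases[OF cong]) (use le N in linarith)+
  moreover have "2 ^ s + 1 + 1 \<noteq> (2::nat) ^ x + 2 ^ k"
  proof
    assume "2 ^ s + 1 + 1 = (2::nat) ^ x + 2 ^ k"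
    thus False using le N by linarith
  qed
  ultimately have eq: "2 ^ s + 1 = (2::nat) ^ x" by simp
  have "s = 0"
  proof (rule ccontr)
    assume "s \<noteq> 0"
    hence "odd ((2::nat) ^ x)" unfolding eq[symmetric] by simp
    hence "x = 0" by simp
    thus False using eq by simp
  qed
  moreover from this have "(2::nat) ^ x = 2 ^ 1" using eq by simp
  hence "x = 1" by (rule power_inject_exp[THEN iffD1, rotated]) simp
  ultimately show "s = 0 \<and> x = 1" by simp
qed (auto simp: numeral_2_eq_2)

text \<open>The solutions come from \<open>1 + 2 + 1 = 4\<close> and from
  \<open>2 ^ (k - 1) + 2 ^ (k - 1) + 1\<close>, which is congruent to 2. The exponent
  \<open>2 mod k\<close> covers \<open>k = 2\<close>, where 4 is congruent to 1.\<close>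

lemma power_2_plus_power_2_plus_1_cong:
  assumes k: "k \<ge> 2" and less: "y < k" "z < k" "x < k"
  shows "[2 ^ y + 2 ^ z + 1 = (2 :: nat) ^ x] (mod (2 ^ k - 1)) \<longleftrightarrow>
    (y = 0 \<and> z = 1 \<and> x = 2 mod k) \<or> (y = 1 \<and> z = 0 \<and> x = 2 mod k) \<or>
    (y = k - 1 \<and> z = k - 1 \<and> x = 1)"  (is "?L \<longleftrightarrow> ?R")
proof
  assume cong: ?L
  obtain j where j: "k = j + 2" using k by (metis add.commute le_Suc_ex)
  have N: "(2 :: nat) ^ k = 4 * 2 ^ j" "(2 :: nat) ^ (j + 1) = 2 * 2 ^ j" "(1 :: nat) \<le> 2 ^ x"
    by (simp_all add: j)
  have le: "(2 :: nat) ^ y \<le> 2 ^ (j + 1)" "(2 :: nat) ^ z \<le> 2 ^ (j + 1)" "(2 :: nat) ^ x \<le> 2 ^ (j + 1)"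
    "(1::nat) \<le> 2 ^ j" "(1 :: nat) \<le> 2 ^ y" "(1 :: nat) \<le> 2 ^ z" "(1 :: nat) \<le> 2 ^ x"
    using less j power_increasing[of _ "j + 1" "2 :: nat"] by auto
  have "2 ^ y + 2 ^ z + 1 = (2::nat) ^ x \<or> 2 ^ y + 2 ^ z + 1 + 1 = (2::nat) ^ x + 2 ^ k"
    by (rule cong_minus_1_cases[OF cong]) (use le N in linarith)+
  thus ?R
  proof
    assume eq: "2 ^ y + 2 ^ z + 1 = (2::nat) ^ x"
    have "x \<noteq> 0" using eq by (cases "x = 0") auto
    hence "even ((2::nat) ^ x)" by simp
    hence "y = 0 \<or> z = 0" unfolding eq[symmetric] by (cases "y = 0"; cases "z = 0") auto
    thus ?R
    proof
      assume "y = 0"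
      hence "z = 1 \<and> x = 2" using eq by (intro two_plus_power_eq_power) simp
      thus ?R using \<open>y = 0\<close> less by auto
    next
      assume "z = 0"
      hence "y = 1 \<and> x = 2" using eq by (intro two_plus_power_eq_power) simp
      thus ?R using \<open>z = 0\<close> less by auto
    qed
  next
    assume eq: "2 ^ y + 2 ^ z + 1 + 1 = (2::nat) ^ x + 2 ^ k"
    \<comment> \<open>After the wrap-around, \<open>2 ^ y\<close> and \<open>2 ^ z\<close> are at
      most half of \<open>2 ^ k\<close>, which leaves at most 2 for \<open>2 ^ x\<close>.\<close>
    have "(2::nat) ^ x \<le> 2" using eq le j by (simp add: power_add)
    hence "(2::nat) ^ x \<le> 2 ^ 1" by simp
    hence "x \<le> 1" by (rule power_le_imp_le_exp[rotated]) simp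
    then consider "x = 0" | "x = 1" by linarith
    thus ?R
    proof cases
      case 1
      have "even ((2::nat) ^ k)" using k by simp
      moreover have eq': "2 ^ y + 2 ^ z + 1 = (2 :: nat) ^ k" using eq 1 by simp
      ultimately have "y = 0 \<or> z = 0" by (metis even_add even_power odd_one not_gr_zero even_numeral)
      thus ?R
      proof
        assume "y = 0"
        hence "z = 1 \<and> k = 2" using eq' by (intro two_plus_power_eq_power) simp
        thus ?R using \<open>y = 0\<close> 1 by auto
      next
        assume "z = 0"
        hence "y = 1 \<and> k = 2" using eq' by (intro two_plus_power_eq_power) simp
        thus ?R using \<open>z = 0\<close> 1 by auto
      qed
    next
      case 2
      hence "2 ^ y = (2::nat) ^ (j + 1)" "2 ^ z = (2::nat) ^ (j + 1)" using eq le j by (auto simp: power_add)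
      hence "y = j + 1" "z = j + 1" by (auto simp only: power_inject_exp)
      thus ?R using 2 j by simp
    qed
  qed
next
  obtain j where j: "k = j + 2" using k by (metis add.commute le_Suc_ex)
  have "[4 = 2 ^ (2 mod k)] (mod (2 ^ k - 1 :: nat))"
    by (cases "k = 2") (use k in \<open>auto simp: cong_def\<close>)
  moreover have "2 ^ 0 + 2 ^ 1 + 1 = (4 :: nat)" "2 ^ 1 + 2 ^ 0 + 1 = (4 :: nat)" by simp_all
  ultimately have "[2 ^ 0 + 2 ^ 1 + 1 = 2 ^ (2 mod k)] (mod (2 ^ k - 1 :: nat))"
    "[2 ^ 1 + 2 ^ 0 + 1 = 2 ^ (2 mod k)] (mod (2 ^ k - 1 :: nat))" by (simp_all only:)
  moreover have "[2 ^ (k - 1) + 2 ^ (k - 1) + 1 = 2 ^ 1] (mod (2 ^ k - 1 :: nat))"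
  proof -
    have "(1::nat) \<le> 2 ^ k" by simp
    hence "2 ^ (k - 1) + 2 ^ (k - 1) + 1 = (2 ^ k - 1) + (2 ^ 1 :: nat)" using j by (simp add: power_add)
    thus ?thesis by (simp only: cong_def mod_add_self1)
  qed
  moreover assume ?R
  ultimately show ?L by (elim disjE conjE) (simp_all only:)
qed

context even_quadratic_ext
begin

subsection \<open>Necessity of condition (2) for \<open>gcd k l \<ge> 2\<close>\<close>

text \<open>For \<open>g\<close> dividing \<open>k\<close> and arguments in \<open>Fq\<close>, the
  norm to F_{2^g}.\<close>

definition nrm :: "nat \<Rightarrow> 'a \<Rightarrow> 'a" where
  "nrm g x = (\<Prod>i<k div g. x ^ 2 ^ (g * i))"

lemma nrm_mult: "nrm g (x * y) = nrm g x * nrm g y"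
  by (simp add: nrm_def power_mult_distrib prod.distrib)

lemma nrm_eq_0D: "nrm g x = 0 \<Longrightarrow> x = 0"
  by (auto simp: nrm_def)

lemma nrm_frob: "nrm g (x ^ 2 ^ i) = nrm g x ^ 2 ^ i"
  unfolding nrm_def prod_power_distrib by (rule prod.cong) (auto simp: frob_comm)

lemma nrm_frob_eq:
  assumes "g dvd k" "g dvd l" "x \<in> Fq"
  shows "nrm g (x ^ 2 ^ l) = nrm g x"
proof -
  have "nrm g (x ^ 2 ^ g) * x = (\<Prod>i<k div g. x ^ 2 ^ (g * Suc i)) * x ^ 2 ^ (g * 0)"
    by (simp add: nrm_def frob_frob)
  also have "\<dots> = (\<Prod>i<Suc (k div g). x ^ 2 ^ (g * i))"
    unfolding prod.lessThan_Suc_shift by (simp add: mult.commute)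
  also have "\<dots> = nrm g x * x" using assms(1,3) by (simp add: nrm_def Fq_iff)
  finally have eq: "nrm g (x ^ 2 ^ g) * x = nrm g x * x" .
  have *: "nrm g x ^ 2 ^ g = nrm g x"
  proof (cases "x = 0")
    case True
    thus ?thesis by (cases "k div g = 0") (auto simp: nrm_def power_0_left)
  next
    case False
    thus ?thesis using eq by (simp add: nrm_frob)
  qed
  hence "nrm g x ^ 2 ^ (g * i) = nrm g x" for i
    by (induction i) (auto simp flip: frob_frob)
  thus ?thesis using assms(2) by (auto simp: nrm_frob elim!: dvdE)
qed

text \<open>Norms cancel the factor \<open>x\<close> in \<open>psi_singular\<close>. Then
  \<open>P \<alpha>\<close> and \<open>P \<beta>\<close>, of degree below \<open>q / 3\<close>,
  agree at no fewer than \<open>q / 2\<close> points, and their linear coefficients are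
  \<open>\<alpha>\<close> and \<open>\<beta>\<close>.\<close>

lemma nonsingular_eq_of_gcd_ge_2:
  assumes g: "gcd k l \<ge> 2" and ab: "\<alpha> \<in> Fq" "\<beta> \<in> Fq" "c \<in> Fq"
    and no: "\<And>y V. y \<in> mu \<Longrightarrow> V \<in> trace1 \<Longrightarrow> psi l \<alpha> \<beta> c (Upar y V) V \<noteq> 0"
  shows "\<alpha> = \<beta>"
proof -
  define g where "g = gcd k l"
  have g2: "g \<ge> 2" "g dvd k" "g dvd l" using g by (auto simp: g_def)
  define n where "n = k div g"
  have kn: "k = g * n" using g2 by (simp add: n_def)
  have n0: "n > 0" using kn k0 by (cases n) auto
  define P where "P = (\<lambda>\<gamma> :: 'a. \<Prod>i<n. 1 + monom (\<gamma> ^ 2 ^ (g * i)) (2 ^ (g * i)))"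
  have P_nrm: "poly (P \<gamma>) t = nrm g (1 + \<gamma> * t)" for \<gamma> t
    by (simp add: P_def poly_prod poly_monom nrm_def n_def frob_add power_mult_distrib)
  \<comment> \<open>Only the factor for \<open>i = 0\<close> contributes a linear term; all other
    exponents exceed 1.\<close>
  have "coeff (\<Prod>i<Suc j. 1 + monom (\<gamma> ^ 2 ^ (g * i)) (2 ^ (g * i))) 1 = \<gamma>" for \<gamma> :: 'a and j
  proof (induction j)
    case 0
    show ?case by simp
  next
    case (Suc j)
    have "2 ^ 1 \<le> (2::nat) ^ (g * Suc j)" using g2 by (intro power_increasing) auto
    hence "\<not> (2::nat) ^ (g * Suc j) \<le> 1" by simp
    thus ?case using Suc unfolding prod.lessThan_Suc[of _ "Suc j"]
      by (simp only: distrib_left mult_1_right coeff_add mult.commute[of _ "monom _ _"] coeff_monom_mult) simp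
  qed
  from this[of _ "n - 1"] have coeff_P: "coeff (P \<gamma>) 1 = \<gamma>" for \<gamma> using n0 by (simp add: P_def)
  define D where "D = (\<Sum>i<n. 2 ^ (g * i) :: nat)"
  \<comment> \<open>A geometric sum of ratio at least 4; for \<open>g = 1\<close> the degree would
    be too large.\<close>
  have "3 * (\<Sum>i<j. 2 ^ (g * i) :: nat) < 2 ^ (g * j)" for j
  proof (induction j)
    case (Suc j)
    have "2 ^ 2 \<le> (2::nat) ^ g" using g2 by (intro power_increasing) auto
    hence "4 * 2 ^ (g * j) \<le> (2::nat) ^ g * 2 ^ (g * j)" by simp
    also have "\<dots> = 2 ^ (g * Suc j)" by (simp add: power_add)
    finally show ?case using Suc by simp
  qed auto
  from this[of n] have D: "3 * D < 2 ^ k" by (simp add: D_def kn)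
  have deg: "degree (P \<gamma>) \<le> D" for \<gamma>
    unfolding P_def D_def
    by (rule order.trans[OF degree_prod_sum_le])
       (auto intro!: sum_mono degree_add_le order.trans[OF degree_monom_le])
  define T where "T = (\<lambda>y. y + inverse y) ` mu"
  have eq: "poly (P \<alpha>) t = poly (P \<beta>) t" if t: "t \<in> T" for t
  proof -
    obtain y where y: "y \<in> mu" "t = y + inverse y" using t by (auto simp: T_def)
    have tq: "t \<in> Fq" using mu_conj[OF y(1)] unfolding y(2) by (simp add: Fq_iff frob_add power_inverse add.commute)
    obtain x where x: "x \<in> Fq" "x \<noteq> 0" "(x * (1 + \<alpha> * t)) ^ 2 ^ l = x * (1 + \<beta> * t)"
      using psi_singular[OF y(1) ab no[OF y(1)]] y(2) by blast
    have "x * (1 + \<alpha> * t) \<in> Fq" using x(1) tq ab by (intro Fq_closed)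
    hence "nrm g (x * (1 + \<alpha> * t)) = nrm g (x * (1 + \<beta> * t))"
      using nrm_frob_eq[OF g2(2,3)] x(3) by metis
    thus ?thesis unfolding P_nrm nrm_mult using nrm_eq_0D x(2) by auto
  qed
  have "P \<alpha> = P \<beta>"
  proof (rule ccontr)
    assume "P \<alpha> \<noteq> P \<beta>"
    hence "card T \<le> D"
      by (intro card_le_of_poly_roots[of "P \<alpha> - P \<beta>"] degree_diff_le deg) (auto simp: eq)
    thus False using card_mu_trace D by (simp add: T_def)
  qed
  thus ?thesis using coeff_P by metis
qed


subsection \<open>Necessity of condition (2) for coprime \<open>k\<close> and \<open>l\<close>\<close>

lemma Fq_power_cong:
  assumes "U \<in> Fq" "U \<noteq> 0" "[i = j] (mod (2 ^ k - 1))"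
  shows "U ^ i = U ^ j"
proof -
  have 1: "U ^ (2 ^ k - 1) = 1" using assms by (simp add: power_card_minus_1 Fq_iff del: One_nat_def)
  have *: "U ^ n = U ^ (n mod (2 ^ k - 1))" for n
  proof -
    have "U ^ n = U ^ ((2 ^ k - 1) * (n div (2 ^ k - 1)) + n mod (2 ^ k - 1))"
      by (simp only: mult_div_mod_eq)
    also have "\<dots> = (U ^ (2 ^ k - 1)) ^ (n div (2 ^ k - 1)) * U ^ (n mod (2 ^ k - 1))"
      by (simp only: power_add power_mult)
    finally show ?thesis by (simp only: 1 power_one mult_1_left)
  qed
  show ?thesis using *[of i] *[of j] assms(3) by (simp add: cong_def)
qed

lemma card_Fq_nz: "card (Fq - {0}) = 2 ^ k - 1"
  using Fq_closed(1) by (simp add: card_Fq)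

text \<open>Otherwise the difference of the reduced monomials has degree below
  \<open>2 ^ k - 1\<close> but \<open>2 ^ k - 1\<close> roots. This avoids choosing a generator of
  the multiplicative group.\<close>

lemma Fq_power_cong_iff:
  assumes "\<And>U. U \<in> Fq \<Longrightarrow> U \<noteq> 0 \<Longrightarrow> U ^ i = U ^ j"
  shows "[i = j] (mod (2 ^ k - 1))"
proof (rule ccontr)
  assume neq: "\<not> ?thesis"
  define M where "M = (2 :: nat) ^ k - 1"
  have M: "M > 0" using one_less_power[of "2 :: nat" k] k0 by (simp add: M_def)
  have ne: "i mod M \<noteq> j mod M" using neq by (simp add: cong_def M_def)
  define p :: "'a poly" where "p = monom 1 (i mod M) - monom 1 (j mod M)"
  have "coeff p (i mod M) = 1" using ne by (simp add: p_def)
  hence "p \<noteq> 0" by auto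
  moreover have "degree p \<le> M - 1"
  proof -
    have "n mod M \<le> M - 1" for n using mod_less_divisor[OF M, of n] by linarith
    thus ?thesis unfolding p_def by (intro degree_diff_le order.trans[OF degree_monom_le])
  qed
  moreover have "poly p U = 0" if "U \<in> Fq - {0}" for U
  proof -
    have "U ^ (i mod M) = U ^ i" "U ^ (j mod M) = U ^ j"
      using that by (auto intro!: Fq_power_cong simp: M_def cong_def)
    thus ?thesis using assms that by (simp add: p_def poly_monom)
  qed
  ultimately have "card (Fq - {0}) \<le> M - 1" by (rule card_le_of_poly_roots)
  thus False using card_Fq_nz M by (simp add: M_def)
qed

text \<open>Replacing \<open>U\<close> by \<open>h * U\<close> scales the sum by
  \<open>h ^ i / h ^ j\<close>, which differs from 1 for a suitable \<open>h\<close>. In the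
  congruent case there are \<open>2 ^ k - 1\<close> terms equal to 1, an odd number. The quotient
  form allows negative exponents.\<close>

lemma sum_Fq_powers:
  "(\<Sum>U\<in>Fq - {0}. U ^ i / U ^ j) = (if [i = j] (mod (2 ^ k - 1)) then 1 else 0)"
proof (cases "[i = j] (mod (2 ^ k - 1))")
  case True
  have "(\<Sum>U\<in>Fq - {0}. U ^ i / U ^ j) = (\<Sum>U\<in>Fq - {0}. 1)"
    using Fq_power_cong[OF _ _ True] by (intro sum.cong) auto
  also have "\<dots> = of_nat (2 ^ k - 1)" by (simp add: card_Fq_nz del: card_Diff_insert)
  also have "\<dots> = 1" by (rule of_nat_odd) (use k0 in simp)
  finally show ?thesis using True by simp
next
  case False
  then obtain h where h: "h \<in> Fq" "h \<noteq> 0" "h ^ i \<noteq> h ^ j" using Fq_power_cong_iff by blast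
  let ?S = "\<Sum>U\<in>Fq - {0}. U ^ i / U ^ j"
  have bij: "bij_betw (\<lambda>U. h * U) (Fq - {0}) (Fq - {0})"
    by (rule bij_betw_byWitness[where f' = "\<lambda>U. inverse h * U"]) (use h Fq_closed in auto)
  have "?S = (\<Sum>U\<in>Fq - {0}. (h * U) ^ i / (h * U) ^ j)"
    by (rule sum.reindex_bij_betw[OF bij, symmetric])
  also have "\<dots> = h ^ i / h ^ j * ?S" by (simp add: power_mult_distrib sum_distrib_left)
  finally have "?S * (h ^ i / h ^ j - 1) = 0" by (simp add: algebra_simps)
  moreover have "h ^ i / h ^ j - 1 \<noteq> 0" using h by simp
  ultimately have "?S = 0" by (metis mult_eq_0_iff)
  thus ?thesis using False by simp
qed

lemma power_2_mod_cong: "[2 ^ n = 2 ^ (n mod k)] (mod (2 ^ k - 1 :: nat))"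
proof -
  have "[(2::nat) ^ k = 1] (mod (2 ^ k - 1))"
    by (metis cong_def le_add_diff_inverse2 mod_add_self1 add.commute one_le_numeral one_le_power)
  hence "[(2 ^ k) ^ (n div k) * 2 ^ (n mod k) = 1 ^ (n div k) * (2 :: nat) ^ (n mod k)] (mod (2 ^ k - 1))"
    by (intro cong_mult cong_pow) auto
  thus ?thesis by (simp add: power_mult[symmetric] power_add[symmetric])
qed

lemma tr_1_alt: "tr 1 x = (\<Sum>i<k. x ^ 2 ^ i)" by (simp add: tr_alt)

lemma Fq_frob_dvd: "x \<in> Fq \<Longrightarrow> k dvd n \<Longrightarrow> x ^ 2 ^ n = x"
proof -
  assume x: "x \<in> Fq" "k dvd n"
  have "x ^ 2 ^ (k * t) = x" for t
    by (induction t) (use x in \<open>auto simp: Fq_iff simp flip: frob_frob\<close>)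
  thus ?thesis using x by auto
qed

text \<open>
  The sums below run over \<open>U\<close>-monomials whose exponents are sums of few powers of two, so only the
  coincidences of such sums modulo \<open>2 ^ k - 1\<close> contribute.
\<close>

lemma weighted_sum_const:
  assumes k: "k \<ge> 2"
  shows "(\<Sum>U\<in>Fq - {0}. U * (tr 1 (w / U ^ 2) * tr 1 (b * U))) = w * b"
proof -
  have "(\<Sum>U\<in>Fq - {0}. U * (tr 1 (w / U ^ 2) * tr 1 (b * U))) =
    (\<Sum>U\<in>Fq - {0}. \<Sum>t<k. \<Sum>s<k. w ^ 2 ^ t * b ^ 2 ^ s * (U ^ (2 ^ s + 1) / U ^ 2 ^ (t + 1)))"
    unfolding tr_1_alt
    by (simp add: sum_product sum_distrib_left sum_divide_distrib power_mult_distrib power_divide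
        power_mult[symmetric] ac_simps)
  also have "\<dots> = (\<Sum>t<k. \<Sum>s<k. \<Sum>U\<in>Fq - {0}. w ^ 2 ^ t * b ^ 2 ^ s * (U ^ (2 ^ s + 1) / U ^ 2 ^ (t + 1)))"
    by (subst sum.swap) (intro sum.cong refl sum.swap)
  also have "\<dots> = (\<Sum>t<k. \<Sum>s<k. if t = 0 \<and> s = 0 then w * b else 0)"
  proof (intro sum.cong refl)
    fix t s assume ts: "t \<in> {..<k}" "s \<in> {..<k}"
    \<comment> \<open>As \<open>t + 1\<close> may equal \<open>k\<close>, it is reduced modulo
      \<open>k\<close> before the classification applies.\<close>
    have "[2 ^ s + 1 = 2 ^ (t + 1)] (mod (2 ^ k - 1 :: nat)) \<longleftrightarrow>
      [2 ^ s + 1 = 2 ^ ((t + 1) mod k)] (mod (2 ^ k - 1 :: nat))"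
      using power_2_mod_cong cong_trans cong_sym by blast
    also have "\<dots> \<longleftrightarrow> s = 0 \<and> (t + 1) mod k = 1"
      using power_2_plus_1_cong[OF k] ts k by auto
    also have "(t + 1) mod k = 1 \<longleftrightarrow> t = 0"
      using ts k by (cases "t + 1 = k") auto
    finally show "(\<Sum>U\<in>Fq - {0}. w ^ 2 ^ t * b ^ 2 ^ s * (U ^ (2 ^ s + 1) / U ^ 2 ^ (t + 1))) =
        (if t = 0 \<and> s = 0 then w * b else 0)"
      unfolding sum_distrib_left[symmetric] sum_Fq_powers by auto
  qed
  also have "\<dots> = (\<Sum>t<k. if t = 0 then w * b else 0)"
    using k0 by (intro sum.cong) auto
  also have "\<dots> = w * b" using k0 by simp
  finally show ?thesis .
qed

text \<open>The surviving index pairs \<open>(t, s)\<close> are \<open>(1, 1)\<close>,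
  \<open>(1, 0)\<close> and \<open>(0, k - 1)\<close>; where their divisibility conditions hold,
  they contribute \<open>b ^ 3\<close>, \<open>b ^ 3\<close> and \<open>b\<close>.\<close>

lemma weighted_sum_frob:
  assumes k: "k \<ge> 2" and b: "b \<in> Fq"
  shows "(\<Sum>U\<in>Fq - {0}. U * (tr 1 ((b * U) ^ 2 ^ j / U ^ 2) * tr 1 (b * U))) =
    (if k dvd j + 1 then b ^ 3 + b else 0) + (if k dvd j then b ^ 3 else 0)"
proof -
  define F where "F = (\<lambda>t s. b ^ 2 ^ (j + t) * b ^ 2 ^ s)"
  define E where "E = (\<lambda>t s. 2 ^ (j + t) + 2 ^ s + (1 :: nat))"
  have "(\<Sum>U\<in>Fq - {0}. U * (tr 1 ((b * U) ^ 2 ^ j / U ^ 2) * tr 1 (b * U))) =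
    (\<Sum>U\<in>Fq - {0}. \<Sum>t<k. \<Sum>s<k. F t s * (U ^ E t s / U ^ 2 ^ (t + 1)))"
    unfolding tr_1_alt
    by (simp add: sum_product sum_distrib_left sum_divide_distrib power_mult_distrib power_divide F_def E_def
        power_add power_mult[symmetric] ac_simps)
  also have "\<dots> = (\<Sum>t<k. \<Sum>s<k. \<Sum>U\<in>Fq - {0}. F t s * (U ^ E t s / U ^ 2 ^ (t + 1)))"
    by (subst sum.swap) (intro sum.cong refl sum.swap)
  \<comment> \<open>The conditionals are nested so that the double sum collapses one index at a
    time.\<close>
  also have "\<dots> = (\<Sum>t<k. \<Sum>s<k.
    (if t = 1 then if s = 1 then if k dvd j + 1 then F t s else 0 else 0 else 0) +
    ((if t = 1 then if s = 0 then if k dvd j then F t s else 0 else 0 else 0) +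
     (if t = 0 then if s = k - 1 then if k dvd j + 1 then F t s else 0 else 0 else 0)))"
  proof (intro sum.cong refl)
    fix t s assume ts: "t \<in> {..<k}" "s \<in> {..<k}"
    have "[2 ^ ((j + t) mod k) + 2 ^ s + 1 = E t s] (mod (2 ^ k - 1))"
      unfolding E_def using power_2_mod_cong[of "j + t"] by (intro cong_add cong_refl) (rule cong_sym)
    hence "[E t s = 2 ^ (t + 1)] (mod (2 ^ k - 1)) \<longleftrightarrow>
      [2 ^ ((j + t) mod k) + 2 ^ s + 1 = 2 ^ ((t + 1) mod k)] (mod (2 ^ k - 1 :: nat))"
      using power_2_mod_cong[of "t + 1"] cong_trans cong_sym by blast
    also have "\<dots> \<longleftrightarrow> ((j + t) mod k = 0 \<and> s = 1 \<and> (t + 1) mod k = 2 mod k) \<or>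
      ((j + t) mod k = 1 \<and> s = 0 \<and> (t + 1) mod k = 2 mod k) \<or>
      ((j + t) mod k = k - 1 \<and> s = k - 1 \<and> (t + 1) mod k = 1)"
      using power_2_plus_power_2_plus_1_cong[OF k] ts k by auto
    also have "(t + 1) mod k = 1 \<longleftrightarrow> t = 0"
      using ts k by (cases "t + 1 = k") auto
    also have "(t + 1) mod k = 2 mod k \<longleftrightarrow> t = 1"
      using ts k by (cases "t + 1 = k"; cases "k = 2") auto
    also have "((j + t) mod k = 0 \<and> s = 1 \<and> t = 1) \<or> ((j + t) mod k = 1 \<and> s = 0 \<and> t = 1) \<or>
       ((j + t) mod k = k - 1 \<and> s = k - 1 \<and> t = 0) \<longleftrightarrow>
      (t = 1 \<and> s = 1 \<and> k dvd j + 1) \<or> (t = 1 \<and> s = 0 \<and> k dvd j) \<or> (t = 0 \<and> s = k - 1 \<and> k dvd j + 1)"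
    proof -
      have "(j + 1) mod k = 1 \<longleftrightarrow> k dvd j" "j mod k = k - 1 \<longleftrightarrow> k dvd j + 1"
        using k by (auto simp: mod_Suc dvd_eq_mod_eq_0 split: if_splits)
      hence "t = 1 \<Longrightarrow> (j + t) mod k = 1 \<longleftrightarrow> k dvd j" "t = 0 \<Longrightarrow> (j + t) mod k = k - 1 \<longleftrightarrow> k dvd j + 1"
        "t = 1 \<Longrightarrow> (j + t) mod k = 0 \<longleftrightarrow> k dvd j + 1" by (simp_all add: dvd_eq_mod_eq_0)
      thus ?thesis by metis
    qed
    finally show "(\<Sum>U\<in>Fq - {0}. F t s * (U ^ E t s / U ^ 2 ^ (t + 1))) =
      (if t = 1 then if s = 1 then if k dvd j + 1 then F t s else 0 else 0 else 0) +
      ((if t = 1 then if s = 0 then if k dvd j then F t s else 0 else 0 else 0) +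
       (if t = 0 then if s = k - 1 then if k dvd j + 1 then F t s else 0 else 0 else 0))"
      unfolding sum_distrib_left[symmetric] sum_Fq_powers by auto
  qed
  also have "\<dots> = (if k dvd j + 1 then F 1 1 else 0) + ((if k dvd j then F 1 0 else 0) +
    (if k dvd j + 1 then F 0 (k - 1) else 0))"
  proof -
    have *: "(\<Sum>t<k. \<Sum>s<k. if t = t0 then if s = s0 then G t s else 0 else 0) = (G t0 s0 :: 'a)"
      if "t0 < k" "s0 < k" for t0 s0 and G
    proof -
      have "(\<Sum>t<k. \<Sum>s<k. if t = t0 then if s = s0 then G t s else 0 else 0) =
        (\<Sum>t<k. if t = t0 then G t s0 else 0)"
        using that by (intro sum.cong) auto
      thus ?thesis using that by simp
    qed
    show ?thesis unfolding sum.distrib using k by (simp only: * pos2 zero_less_diff)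
  qed
  also have "F 1 1 = b ^ 3" if "k dvd j + 1"
    using Fq_frob_dvd[OF b that] by (simp add: F_def power3_eq_cube power2_eq_square)
  hence "(if k dvd j + 1 then F 1 1 else 0) = (if k dvd j + 1 then b ^ 3 else 0)" by simp
  also have "F 1 0 = b ^ 3" if "k dvd j"
  proof -
    have "b ^ 2 ^ (j + 1) = b ^ 2" using Fq_frob_dvd[OF b that] frob_frob[of b j 1] by simp
    thus ?thesis unfolding F_def by (simp only: power_0 power_one_right) (simp add: power3_eq_cube power2_eq_square)
  qed
  hence "(if k dvd j then F 1 0 else 0) = (if k dvd j then b ^ 3 else 0)" by simp
  also have "F 0 (k - 1) = b" if dvd: "k dvd j + 1"
  proof -
    obtain c where c: "j + 1 = k * c" using dvd by (elim dvdE)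
    then obtain c' where "c = Suc c'" by (cases c) auto
    hence "j = k * c' + (k - 1)" using c k0 by simp
    hence "b ^ 2 ^ j = b ^ 2 ^ (k - 1)" using Fq_frob_dvd[OF b, of "k * c'"] by (simp flip: frob_frob)
    hence "F 0 (k - 1) = (b ^ 2 ^ (k - 1)) ^ 2 ^ 1" by (simp add: F_def power2_eq_square)
    also have "\<dots> = b" using b k0 by (simp only: frob_frob) (simp add: Fq_iff)
    finally show ?thesis .
  qed
  hence "(if k dvd j + 1 then F 0 (k - 1) else 0) = (if k dvd j + 1 then b else 0)" by simp
  finally show ?thesis by simp
qed


section \<open>Solving for \<open>W ^ 2 + W\<close> in terms of \<open>W ^ Q + W\<close>\<close>

definition Theta :: "nat \<Rightarrow> nat \<Rightarrow> 'a \<Rightarrow> 'a" where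
  "Theta l s x = (\<Sum>i<s. x ^ 2 ^ (l * i))"

lemma Theta_add: "Theta l s (x + y) = Theta l s x + Theta l s y"
  by (simp add: Theta_def frob_add sum.distrib)

lemma Theta_frob: "Theta l s (x ^ 2 ^ i) = Theta l s x ^ 2 ^ i"
  unfolding Theta_def frob_sum by (rule sum.cong) (auto simp: frob_comm)

text \<open>With \<open>l * s\<close> congruent to 1 modulo \<open>2 * k\<close> the right side
  becomes \<open>x ^ 2 + x\<close>.\<close>

lemma Theta_telescope: "Theta l s (x ^ 2 ^ l + x) = x ^ 2 ^ (l * s) + x"
  unfolding Theta_def by (induction s) (auto simp: frob_add frob_frob add_self ac_simps)

lemma Theta_closed: "x \<in> Fq \<Longrightarrow> Theta l s x \<in> Fq"
  unfolding Fq_iff by (simp flip: Theta_frob)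

lemma of_nat_cases: "(of_nat n :: 'a) = 0 \<or> (of_nat n :: 'a) = 1"
  by (cases "even n") (auto elim!: evenE simp: of_nat_odd two_eq_0)

text \<open>An even multiple of \<open>k\<close> is wanted because the \<open>2 ^ (2 * k)\<close>
  Frobenius is the identity on all of F_{q^2}. Adding \<open>k\<close> to \<open>s\<close> adds the
  odd \<open>l\<close> to \<open>t\<close> and so corrects its parity.\<close>

lemma bezout_even:
  assumes "coprime k l" "odd l"
  obtains s t where "l * s = k * (2 * t) + (1 :: nat)"
proof -
  have "l \<noteq> 0" using assms(2) by (cases l) auto
  from bezout_nat[OF this, of k] obtain s t where st: "l * s = k * t + 1"
    using assms(1) by (auto simp: gcd.commute)
  show ?thesis
  proof (cases "even t")
    case True
    thus ?thesis using st that[of s "t div 2"] by simp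
  next
    case False
    hence "even (t + l)" using assms(2) by simp
    hence "l * (s + k) = k * (2 * ((t + l) div 2)) + 1" using st by (simp add: algebra_simps)
    thus ?thesis by (rule that)
  qed
qed

text \<open>If \<open>\<alpha> \<noteq> \<beta>\<close>, summing \<open>main\<close> over
  \<open>U\<close> determines \<open>K\<close> up to constants in F_2, while \<open>rel\<close>
  prescribes \<open>K + K ^ Q\<close>; the two are incompatible.\<close>

lemma nonsingular_eq_of_coprime:
  assumes cop: "coprime k l" and odd: "odd l" and ab: "\<alpha> \<in> Fq" "\<beta> \<in> Fq" "c \<in> Fq"
    and rel: "c + c ^ 2 = (\<alpha> ^ 2) ^ 2 ^ l + \<beta> ^ 2"
    and no: "\<And>y V. y \<in> mu \<Longrightarrow> V \<in> trace1 \<Longrightarrow> psi l \<alpha> \<beta> c (Upar y V) V \<noteq> 0"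
  shows "\<alpha> = \<beta>"
proof (rule ccontr)
  assume neq: "\<alpha> \<noteq> \<beta>"
  define b where "b = \<alpha> + \<beta>"
  have b0: "b \<noteq> 0" using neq by (simp add: b_def flip: eq_iff_add)
  have bq: "b \<in> Fq" using ab Fq_closed by (simp add: b_def)
  have l0: "l > 0" using odd by (cases l) auto
  have gcd1: "gcd k l = 1" using cop by simp
  \<comment> \<open>Shifting \<open>W\<close> by \<open>\<alpha> * U\<close> absorbs the
    \<open>U ^ Q\<close> term; this is why its coefficient is written as a \<open>Q\<close>-th
    power.\<close>
  have psi_b: "psi l \<alpha> \<beta> c U (W + \<alpha> * U) = W ^ 2 ^ l + W + (b * U + c)" for U W
    by (simp add: psi_def b_def frob_add distrib_left distrib_right ac_simps add_self)
  have solve: "\<exists>W\<in>trace1. W ^ 2 ^ l + W = x" if "x \<in> Fq" "tr 1 x = 1" for x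
    using trace1_solvable[of l x] l0 that odd gcd1 by simp
  have tr_sq: "tr 1 (x ^ 2) = tr 1 x" if "x \<in> Fq" for x by (rule tr_1_square[OF that])

  have tr_c: "tr 1 c = 0"
  proof (rule ccontr)
    assume "tr 1 c \<noteq> 0"
    then obtain V where V: "V \<in> trace1" "V ^ 2 ^ l + V = c" using solve tr_1_cases ab(3) by blast
    obtain y where y: "y \<in> mu" "Upar y V = 0" using mu_sqrt V by blast
    have "psi l \<alpha> \<beta> c (Upar y V) V = 0" using V y by (simp add: psi_def power_0_left add_self)
    thus False using no y V by blast
  qed
  \<comment> \<open>This excludes \<open>k = 1\<close>, where the trace is the identity.\<close>
  have tr_b: "tr 1 b = 0"
  proof -
    have "tr 1 b = tr 1 (\<alpha> ^ 2 + \<beta> ^ 2)" using tr_sq[OF bq] by (simp add: b_def square_add)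
    also have "\<dots> = tr 1 ((\<alpha> ^ 2) ^ 2 ^ l + \<beta> ^ 2)"
      using tr_frob_eq[of 1 l "\<alpha> ^ 2"] ab Fq_closed(7) by (simp add: tr_add)
    also have "\<dots> = 0" unfolding rel[symmetric] using tr_sq[OF ab(3)] by (simp add: tr_add add_self)
    finally show ?thesis .
  qed
  have k2: "k \<ge> 2"
  proof (rule ccontr)
    assume "\<not> k \<ge> 2"
    hence "k = 1" using k0 by simp
    hence "(\<Sum>i<k. b ^ 2 ^ i) = b" by simp
    thus False using tr_b b0 unfolding tr_1_alt by simp
  qed
  \<comment> \<open>Otherwise some \<open>y\<close> in \<open>mu\<close> has
    \<open>y + inverse y = 1 / \<alpha>\<close>. Then the left side in \<open>psi_singular\<close>
    vanishes, which forces \<open>\<beta> = \<alpha>\<close>.\<close>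
  have tr_\<alpha>: "tr 1 \<alpha> = 0"
  proof (rule ccontr)
    assume "tr 1 \<alpha> \<noteq> 0"
    hence "tr 1 (\<alpha> ^ 2) = 1" using tr_sq tr_1_cases ab by metis
    then obtain Y where Y: "Y \<in> trace1" "Y ^ 2 + Y = \<alpha> ^ 2"
      using trace1_artin_schreier[of "\<alpha> ^ 2"] Fq_closed(7) ab(1) by blast
    have \<alpha>0: "\<alpha> \<noteq> 0" using \<open>tr 1 \<alpha> \<noteq> 0\<close> by auto
    define y where "y = Y / \<alpha>"
    have conj: "y ^ 2 ^ k = (Y + 1) / \<alpha>" using Y(1) ab(1) by (simp add: y_def power_divide trace1_def Fq_iff)
    have "y * y ^ 2 ^ k = (Y ^ 2 + Y) / \<alpha> ^ 2"
      unfolding conj by (simp add: y_def power2_eq_square distrib_left add_divide_distrib)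
    hence "y * y ^ 2 ^ k = 1" using Y \<alpha>0 by simp
    hence y: "y \<in> mu" by (simp add: mu_def)
    have "y + inverse y = Y / \<alpha> + (Y + 1) / \<alpha>"
      using mu_conj[OF y] conj by (simp add: y_def)
    also have "\<dots> = 1 / \<alpha>" by (simp add: add_divide_distrib)
    finally have "\<alpha> * (y + inverse y) = 1" using \<alpha>0 by simp
    moreover obtain x where "x \<noteq> 0"
      "(x * (1 + \<alpha> * (y + inverse y))) ^ 2 ^ l = x * (1 + \<beta> * (y + inverse y))"
      using psi_singular[OF y ab no[OF y]] by blast
    ultimately have "1 + \<beta> * (y + inverse y) = 0" by (simp add: add_self power_0_left)
    hence "\<beta> * (y + inverse y) = \<alpha> * (y + inverse y)"
      unfolding \<open>\<alpha> * (y + inverse y) = 1\<close> by (metis eq_iff_add)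
    moreover have "y + inverse y \<noteq> 0" using \<open>\<alpha> * (y + inverse y) = 1\<close> by auto
    ultimately show False using neq by simp
  qed

  obtain s t where st: "l * s = k * (2 * t) + 1" using bezout_even cop odd by blast
  define K where "K = Theta l s c + \<alpha> ^ 2"
  have Kq: "K \<in> Fq" using ab Theta_closed Fq_closed by (simp add: K_def)
  have Theta_eq: "Theta l s (W ^ 2 ^ l + W) = W ^ 2 + W" for W
  proof -
    have "W ^ 2 ^ (k * (2 * t)) = W"
    proof (induction t)
      case (Suc t)
      have "W ^ 2 ^ (k * (2 * Suc t)) = ((W ^ 2 ^ (k * (2 * t))) ^ 2 ^ k) ^ 2 ^ k"
        by (simp add: frob_frob algebra_simps)
      thus ?case using Suc by (simp add: conj_conj)
    qed simp
    hence "W ^ 2 ^ (l * s) = W ^ 2" unfolding st frob_frob[symmetric] by simp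
    thus ?thesis by (simp add: Theta_telescope)
  qed
  \<comment> \<open>If \<open>tr 1 (b * U) = 1\<close>, some \<open>V\<close> solves
    \<open>psi = 0\<close> for this \<open>U\<close>, so no \<open>y\<close> may realise
    \<open>U\<close> and \<open>Upar_solvable\<close> forces a zero trace. The factor
    \<open>tr 1 (b * U)\<close> makes the statement hold for all nonzero \<open>U\<close>.\<close>
  have main: "tr 1 ((Theta l s (b * U) + K) / U ^ 2) * tr 1 (b * U) = 0" if U: "U \<in> Fq" "U \<noteq> 0" for U
  proof (cases "tr 1 (b * U) = 0")
    case False
    have bU: "b * U \<in> Fq" using bq U Fq_closed by auto
    hence "tr 1 (b * U) = 1" using tr_1_cases False by blast
    hence "tr 1 (b * U + c) = 1" using tr_c by (simp add: tr_add)
    then obtain W where W: "W \<in> trace1" "W ^ 2 ^ l + W = b * U + c" using solve[OF Fq_closed(3)[OF bU ab(3)]] by blast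
    define V where "V = W + \<alpha> * U"
    have V: "V \<in> trace1" using W U ab trace1_add_Fq Fq_closed by (simp add: V_def)
    have "psi l \<alpha> \<beta> c U V = 0" unfolding V_def psi_b W(2) by (simp add: add_self)
    hence "\<not> (\<exists>y\<in>mu. Upar y V = U)" using no V by blast
    hence "tr 1 ((V ^ 2 + V) / U ^ 2) \<noteq> 1" using Upar_solvable V U by blast
    moreover have "V ^ 2 + V \<in> Fq" using trace1_diff[OF V trace1_frob[OF V, of 1]] by (simp add: add.commute power2_eq_square)
    hence "(V ^ 2 + V) / U ^ 2 \<in> Fq" by (rule Fq_closed(6)[OF _ Fq_closed(7)[OF U(1)]])
    ultimately have "tr 1 ((V ^ 2 + V) / U ^ 2) = 0" using tr_1_cases by blast
    moreover have "tr 1 ((V ^ 2 + V) / U ^ 2) = tr 1 ((W ^ 2 + W) / U ^ 2 + \<alpha> ^ 2 + \<alpha> / U)"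
      using U(2) by (simp add: V_def square_add power_mult_distrib field_simps power2_eq_square)
    moreover have "tr 1 (\<alpha> ^ 2) = 0" using tr_sq ab tr_\<alpha> by simp
    \<comment> \<open>Squaring turns the cross term into \<open>\<alpha> ^ 2 / U ^ 2\<close>; this
      is the \<open>\<alpha> ^ 2\<close> in \<open>K\<close>.\<close>
    moreover have "tr 1 (\<alpha> / U) = tr 1 ((\<alpha> / U) ^ 2)" using tr_sq[OF Fq_closed(6)[OF ab(1) U(1)]] by simp
    ultimately have "tr 1 ((W ^ 2 + W + \<alpha> ^ 2) / U ^ 2) = 0"
      by (simp add: tr_add add_divide_distrib power_divide)
    moreover have "Theta l s (b * U) + Theta l s c = W ^ 2 + W"
      unfolding Theta_add[symmetric] W(2)[symmetric] by (rule Theta_eq)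
    ultimately show ?thesis unfolding K_def by (simp flip: add.assoc)
  qed simp

  \<comment> \<open>\<open>p\<close> and \<open>r\<close> count modulo 2 the terms of
    \<open>Theta\<close> with \<open>l * i\<close> congruent to -1 and to 0 modulo \<open>k\<close>,
    the only ones that survive in \<open>weighted_sum_frob\<close>.\<close>
  define p where "p = (of_nat (card {i \<in> {..<s}. k dvd l * i + 1}) :: 'a)"
  define r where "r = (of_nat (card {i \<in> {..<s}. k dvd l * i}) :: 'a)"
  \<comment> \<open>With the weight \<open>U\<close>, the constant \<open>K\<close> contributes
    exactly \<open>K * b\<close> by \<open>weighted_sum_const\<close>.\<close>
  have "0 = (\<Sum>U\<in>Fq - {0}. U * (tr 1 ((Theta l s (b * U) + K) / U ^ 2) * tr 1 (b * U)))"
    using main by (intro sum.neutral[symmetric]) auto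
  also have "\<dots> = (\<Sum>U\<in>Fq - {0}. U * (tr 1 (Theta l s (b * U) / U ^ 2) * tr 1 (b * U))) + K * b"
    unfolding weighted_sum_const[OF k2, of K b, symmetric]
    by (simp add: add_divide_distrib tr_add distrib_left distrib_right sum.distrib)
  also have "(\<Sum>U\<in>Fq - {0}. U * (tr 1 (Theta l s (b * U) / U ^ 2) * tr 1 (b * U))) =
      (\<Sum>U\<in>Fq - {0}. \<Sum>i<s. U * (tr 1 ((b * U) ^ 2 ^ (l * i) / U ^ 2) * tr 1 (b * U)))"
  proof (intro sum.cong refl)
    fix U
    have tr_sum: "tr 1 (\<Sum>i<n. g i) = (\<Sum>i<n. tr 1 (g i))" for n :: nat and g
      by (induction n) (simp_all add: tr_add)
    show "U * (tr 1 (Theta l s (b * U) / U ^ 2) * tr 1 (b * U)) =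
      (\<Sum>i<s. U * (tr 1 ((b * U) ^ 2 ^ (l * i) / U ^ 2) * tr 1 (b * U)))"
      unfolding Theta_def sum_divide_distrib tr_sum sum_distrib_left sum_distrib_right ..
  qed
  also have "\<dots> = (\<Sum>i<s. \<Sum>U\<in>Fq - {0}. U * (tr 1 ((b * U) ^ 2 ^ (l * i) / U ^ 2) * tr 1 (b * U)))"
    by (rule sum.swap)
  also have "\<dots> = (\<Sum>i<s. (if k dvd l * i + 1 then b ^ 3 + b else 0) + (if k dvd l * i then b ^ 3 else 0))"
    by (simp only: weighted_sum_frob[OF k2 bq])
  also have "\<dots> = p * (b ^ 3 + b) + r * b ^ 3"
    unfolding sum.distrib p_def r_def by (simp add: sum.If_cases Int_def)
  finally have "b * (p * (b ^ 2 + 1) + r * b ^ 2 + K) = 0"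
    by (simp add: algebra_simps power2_eq_square power3_eq_cube)
  hence K: "K = p * (b ^ 2 + 1) + r * b ^ 2" using b0 by (metis eq_iff_add mult_eq_0_iff add.commute)

  have "K + K ^ 2 ^ l = Theta l s (c ^ 2 ^ l + c) + (\<alpha> ^ 2 + (\<alpha> ^ 2) ^ 2 ^ l)"
    by (simp add: K_def frob_add Theta_add Theta_frob ac_simps)
  also have "\<dots> = (c + c ^ 2) + (\<alpha> ^ 2 + (\<alpha> ^ 2) ^ 2 ^ l)" unfolding Theta_eq by (simp add: add.commute)
  also have "\<dots> = b ^ 2" unfolding rel b_def square_add by (simp add: ac_simps add_self)
  finally have *: "K + K ^ 2 ^ l = b ^ 2" .
  \<comment> \<open>\<open>K\<close> is 0, 1, \<open>b ^ 2\<close> or \<open>b ^ 2 + 1\<close>. The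
    first two give \<open>b ^ 2 = 0\<close>, the others \<open>(b ^ 2) ^ Q = 0\<close>.\<close>
  have "b ^ 2 = 0 \<or> (b ^ 2) ^ 2 ^ l = 0"
    using of_nat_cases[of "card {i \<in> {..<s}. k dvd l * i + 1}", folded p_def]
      of_nat_cases[of "card {i \<in> {..<s}. k dvd l * i}", folded r_def] *
    unfolding K by (elim disjE) (auto simp: frob_add ac_simps add_self power_0_left)
  thus False using b0 by simp
qed

end

subsection \<open>The permutation criterion\<close>

text \<open>If \<open>l'\<close> were even, \<open>k'\<close> would be odd by coprimality, and
  \<open>2 ^ g + 1\<close> would divide both \<open>2 ^ k + 1\<close> and
  \<open>2 ^ l - 1\<close>.\<close>

lemma odd_div_gcd_of_gcd_eq_1:
  fixes k l :: nat
  assumes "k > 0" "gcd (2 ^ l - 1) (2 ^ k + 1) = (1 :: nat)"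
  shows "odd (l div gcd k l)"
proof
  assume even: "even (l div gcd k l)"
  define g where "g = gcd k l"
  define k' l' where "k' = k div g" and "l' = l div g"
  have eq: "k = g * k'" "l = g * l'" by (simp_all add: k'_def l'_def g_def)
  have cop: "coprime k' l'" unfolding k'_def l'_def g_def by (rule div_gcd_coprime) (use assms in auto)
  have even': "even l'" using even by (simp add: l'_def g_def)
  have odd: "odd k'" using coprime_common_divisor[OF cop _ even'] by auto
  define M where "M = (2 :: int) ^ g + 1"
  have c: "[2 ^ g = - 1] (mod M)" by (simp add: M_def cong_iff_dvd_diff)
  have "[(2 ^ g) ^ k' = (- 1) ^ k'] (mod M)" "[(2 ^ g) ^ l' = (- 1) ^ l'] (mod M)"
    using c by (auto intro: cong_pow)
  hence "M dvd 2 ^ k + 1" "M dvd 2 ^ l - 1"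
    using odd even' by (simp_all add: cong_iff_dvd_diff eq power_mult)
  moreover have "M = int (2 ^ g + 1)" "(2 :: int) ^ k + 1 = int (2 ^ k + 1)" "(2 :: int) ^ l - 1 = int (2 ^ l - 1)"
    by (simp_all add: M_def of_nat_diff)
  ultimately have "2 ^ g + 1 dvd (2 :: nat) ^ k + 1" "2 ^ g + 1 dvd (2 :: nat) ^ l - 1"
    by (simp_all only: int_dvd_int_iff)
  hence "2 ^ g + 1 dvd gcd (2 ^ l - 1) (2 ^ k + 1 :: nat)" by (intro gcd_greatest)
  thus False unfolding assms(2) by simp
qed

context even_quadratic_ext
begin

text \<open>Necessity is shown for the trace to F_{2^g} with \<open>g = gcd k l\<close> and passes
  to F_{2^m} by transitivity. Sufficiency uses the trace to F_{2^m} directly, as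
  \<open>l div m\<close> is odd.\<close>

lemma no_collision_iff:
  assumes l: "l > 0" "odd (l div gcd k l)" and m: "m dvd gcd k l" "odd (gcd k l div m)"
    and ab: "\<alpha> \<in> Fq" "\<beta> \<in> Fq" "c \<in> Fq" and rel: "c + c ^ 2 = (\<alpha> ^ 2) ^ 2 ^ l + \<beta> ^ 2"
  shows "(\<forall>y\<in>mu. \<forall>V\<in>trace1. psi l \<alpha> \<beta> c (Upar y V) V \<noteq> 0) \<longleftrightarrow> \<alpha> = \<beta> \<and> tr m c = 0"
proof (intro iffI conjI ballI)
  assume "\<forall>y\<in>mu. \<forall>V\<in>trace1. psi l \<alpha> \<beta> c (Upar y V) V \<noteq> 0"
  hence no: "\<And>y V. y \<in> mu \<Longrightarrow> V \<in> trace1 \<Longrightarrow> psi l \<alpha> \<beta> c (Upar y V) V \<noteq> 0" by blast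
  define g where "g = gcd k l"
  have g: "g dvd k" "g dvd l" "g > 0" using k0 by (auto simp: g_def)
  show eq: "\<alpha> = \<beta>"
  proof (cases "g = 1")
    case True
    hence "coprime k l" "odd l" using l(2) by (simp_all add: g_def coprime_iff_gcd_eq_1)
    thus ?thesis by (rule nonsingular_eq_of_coprime[OF _ _ ab rel no])
  next
    case False
    hence "gcd k l \<ge> 2" using g(3) unfolding g_def by linarith
    thus ?thesis by (rule nonsingular_eq_of_gcd_ge_2[OF _ ab no])
  qed
  \<comment> \<open>Given \<open>\<alpha> = \<beta>\<close>, \<open>rel\<close> forces this trace
    into F_2, so only the value 1 has to be excluded.\<close>
  have "tr g c + tr g c ^ 2 = tr g (c + c ^ 2)" using tr_frob[of g c 1] by (simp add: tr_add)
  also have "\<dots> = 0"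
    unfolding rel tr_add eq using tr_frob_eq[OF g(1,2), of "\<beta> ^ 2"] ab(2) Fq_closed(7)
    by (simp add: add_self)
  finally have "tr g c * (1 + tr g c) = 0" by (simp add: power2_eq_square distrib_left)
  hence "tr g c = 0 \<or> tr g c = 1" by (metis eq_iff_add mult_eq_0_iff)
  moreover have "tr g c \<noteq> 1"
  proof
    assume "tr g c = 1"
    then obtain V where V: "V \<in> trace1" "V ^ 2 ^ l + V = c" using trace1_solvable[OF l ab(3)] by (auto simp: g_def)
    obtain y where y: "y \<in> mu" "Upar y V = 0" using mu_sqrt V by blast
    have "psi l \<alpha> \<beta> c (Upar y V) V = 0" using V y by (simp add: psi_def power_0_left add_self)
    thus False using no y V by blast
  qed
  ultimately have "tr g c = 0" by blast
  thus "tr m c = 0" using tr_trans[of m g c] m g by (simp add: g_def power_0_left)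
next
  fix y V assume *: "\<alpha> = \<beta> \<and> tr m c = 0" and y: "y \<in> mu" and V: "V \<in> trace1"
  have "m dvd k" "m dvd l" using m(1) by (auto intro: dvd_trans)
  moreover have "odd (l div m)"
  proof -
    have "l div m = (l div gcd k l) * (gcd k l div m)" using m(1) by (simp add: div_mult_div_if_dvd)
    thus ?thesis using l m by simp
  qed
  ultimately have "tr m (psi l \<alpha> \<beta> c (Upar y V) V) = 1"
    using tr_psi[OF _ _ _ V ab(1) Upar_Fq[OF y V]] * by (simp add: add_self)
  thus "psi l \<alpha> \<beta> c (Upar y V) V \<noteq> 0" by auto
qed

end

theorem corollary9p9:
  fixes k l m q Q u v :: nat
    and a d e :: "'a :: finite_field"
    and A f :: "'a poly"
  assumes "k > 0" and "l > 0"
    and "m = 2 ^ multiplicity 2 (gcd k l)"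
    and "q = 2 ^ k" and "Q = 2 ^ l"
    and "gcd (Q - 1) (q + 1) = 1"
    and "CARD('a) = q ^ 2"
    and "a \<in> GF_sub q" and "d \<in> GF_sub q"
    and "u > 0" and "v > 0"
    and "[u * (Q - 1) = Q] (mod (q + 1))"
    and "[v * (Q - 1) = q] (mod (q + 1))"
    and "A = 1 + monom a u + monom d v"
    and "f = monom 1 1 * pcompose A (monom 1 (q - 1))"
    and "e = 1 + a ^ 2 + d ^ 2"
  shows "bij (poly f) \<longleftrightarrow>
           e \<noteq> 0 \<and>
           d ^ Q = e ^ (Q - 1) * a \<and>
           GF_trace (2 ^ m) (k div m) ((a ^ 2 + d ^ 2) / e) = 0"
proof -
  note q = \<open>q = 2 ^ k\<close> and Q = \<open>Q = 2 ^ l\<close> and e = \<open>e = 1 + a ^ 2 + d ^ 2\<close>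
  interpret even_quadratic_ext k "TYPE('a)"
    by unfold_locales (use assms in auto)
  have ad: "a \<in> Fq" "d \<in> Fq" using assms by simp_all
  have perm: "bij (poly f) \<longleftrightarrow> (\<forall>y\<in>mu. \<forall>V\<in>trace1. collision l a d (Upar y V) V \<noteq> 0)"
    by (rule perm_iff_collision[of l a d u v A f]) (use assms in simp_all)
  show ?thesis
  proof (cases "e = 0")
    case True
    obtain V where V: "V \<in> trace1" using trace1_ex by blast
    \<comment> \<open>Here \<open>e\<close> is the square of \<open>1 + a + d\<close>. At
      \<open>y = 1\<close> the parameter \<open>Upar\<close> is 1 for every \<open>V\<close>, so the
      collision expression reduces to \<open>a + d + 1\<close>.\<close>
    have "(1 + a + d) ^ 2 = 0" using True by (simp add: e square_add)
    hence "1 + a + d = 0" by simp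
    hence "collision l a d (Upar 1 V) V = 0"
      unfolding collision_def e[symmetric] using True by (simp add: Upar_def add_self ac_simps)
    thus ?thesis using True perm V one_in_mu by blast
  next
    case False
    obtain \<alpha> where \<alpha>: "\<alpha> ^ 2 ^ l = a / e" using frob_surj by blast
    have eq: "e \<in> Fq" unfolding e using ad Fq_closed(2,3,7) by simp
    have \<alpha>q: "\<alpha> \<in> Fq" using Fq_frob_iff[of \<alpha> l] \<alpha> Fq_closed(6)[OF ad(1) eq] by simp
    have \<beta>q: "d / e \<in> Fq" using Fq_closed(6)[OF ad(2) eq] .
    have c: "1 + 1 / e = (a ^ 2 + d ^ 2) / e"
    proof -
      have "a ^ 2 + d ^ 2 = e + 1" unfolding e by (simp add: ac_simps add_self)
      thus ?thesis using False by (simp add: add_divide_distrib)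
    qed
    have cq: "(a ^ 2 + d ^ 2) / e \<in> Fq" using ad eq Fq_closed(3,6,7) by simp
    \<comment> \<open>As \<open>e = 1 + x\<close>, the element \<open>x / e\<close> plus its square
      is \<open>x / e ^ 2\<close>, the sum of the squares of \<open>a / e\<close> and
      \<open>d / e\<close>.\<close>
    define x where "x = a ^ 2 + d ^ 2"
    have "x * (e + x) = x" unfolding e x_def by (simp add: add.assoc add_self)
    hence "x / e + (x / e) ^ 2 = x / e ^ 2" using False
      by (simp add: field_simps power2_eq_square)
    hence rel: "x / e + (x / e) ^ 2 = (\<alpha> ^ 2) ^ 2 ^ l + (d / e) ^ 2"
      by (simp add: square_frob \<alpha> power_divide x_def add_divide_distrib)
    have odd: "odd (l div gcd k l)"
      by (rule odd_div_gcd_of_gcd_eq_1) (use assms in auto)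
    have g0: "gcd k l \<noteq> 0" using k0 by simp
    have m: "m dvd gcd k l" "odd (gcd k l div m)"
      unfolding \<open>m = _\<close> using multiplicity_dvd[of 2 "gcd k l"] multiplicity_decompose[of "gcd k l" 2] g0 by auto
    have "bij (poly f) \<longleftrightarrow> (\<forall>y\<in>mu. \<forall>V\<in>trace1. psi l \<alpha> (d / e) ((a ^ 2 + d ^ 2) / e) (Upar y V) V \<noteq> 0)"
      using perm collision_psi[of a d \<alpha> l] False \<alpha> unfolding e[symmetric] c by simp
    also have "\<dots> \<longleftrightarrow> \<alpha> = d / e \<and> tr m ((a ^ 2 + d ^ 2) / e) = 0"
      by (rule no_collision_iff[OF \<open>l > 0\<close> odd m \<alpha>q \<beta>q cq rel[unfolded x_def]])
    \<comment> \<open>Raising to the \<open>Q\<close>-th power is injective and replaces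
      \<open>\<alpha>\<close> by \<open>a / e\<close>.\<close>
    also have "\<alpha> = d / e \<longleftrightarrow> d ^ Q = e ^ (Q - 1) * a"
    proof -
      have "\<alpha> = d / e \<longleftrightarrow> a / e = (d / e) ^ 2 ^ l" using frob_inj[of \<alpha> l "d / e"] by (simp only: \<alpha>)
      also have "\<dots> \<longleftrightarrow> d ^ 2 ^ l = e ^ 2 ^ l / e * a" using False by (auto simp: field_simps power_divide)
      finally show ?thesis using False by (simp add: Q power_card_minus_1 del: One_nat_def)
    qed
    finally show ?thesis using False by (simp add: tr_def)
  qed
qed

end
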